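(* In the large-system setting of the context, let $\mathbf{q}\in\mathbb{R}_{++}^{JK}$ be a given (deterministic) dual power vector and, for each user $m$, let $$\Gamma_m^{\mathsf{DN}}(\mathbf{q})=\frac{q_m d_{m,m}}{N}\,\tilde{\mathbf{h}}_{m,m}^{\dagger}\Big(\sum_{n\ne m}\frac{q_n d_{m,n}}{N}\tilde{\mathbf{h}}_{m,n}\tilde{\mathbf{h}}_{m,n}^{\dagger}+w_m\mathbf{I}\Big)^{-1}\tilde{\mathbf{h}}_{m,m}.$$ Then for every user $m$ the random variable $\Gamma_m^{\mathsf{DN}}(\mathbf{q})$ is approximated by a deterministic quantity $\gamma_m^{\mathsf{DN}}(\mathbf{q})>0$ in the sense that $$\Gamma_m^{\mathsf{DN}}(\mathbf{q})-\gamma_m^{\mathsf{DN}}(\mathbf{q})\longrightarrow 0\quad\text{almost surely as }N\to\infty,$$ where $\gamma_m^{\mathsf{DN}}(\mathbf{q})$ is described by the fixed-point equation $$\gamma_m^{\mathsf{DN}}(\mathbf{q})=\frac{q_m d_{m,m}}{w_m+\frac1N\sum_{n\ne m}\frac{q_n q_m d_{m,n}d_{m,m}}{q_m d_{m,m}+q_n d_{m,n}\gamma_m^{\mathsf{DN}}(\mathbf{q})}}.$$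
   Context: There are $J$ cells ($J$ fixed), each with a base station with $N$ antennas serving $K$ users; users are indexed by $m=1,\dots,JK$, where $m=(j-1)K+k$ stands for user $k$ of cell $j$. "$N\to\infty$" means that $N$ and $K=K(N)$ go to infinity with $\liminf K/N>0$ and $\limsup K/N<\infty$; "user $m$" means a fixed pair (cell $j$, user $k$) as $N\to\infty$. The channel from the base station serving user $m$ to user $n$ is $\mathbf{h}_{m,n}=\sqrt{d_{m,n}}\,\tilde{\mathbf{h}}_{m,n}\in\mathbb{C}^{N\times1}$, where $d_{m,n}>0$ is a deterministic large-scale coefficient and $\tilde{\mathbf{h}}_{m,n}$ has i.i.d. $\mathcal{CN}(0,1)$ (circularly symmetric complex Gaussian) entries; $\mathbf{h}_{m,n}$ depends on $m$ only through the cell of $m$, and the vectors $\tilde{\mathbf{h}}$ for distinct (base station, user) pairs are independent. For all $N$ the variables are defined on a common probability space. The numbers $w_m>0$ are fixed weights (the noise powers of the dual uplink), not depending on $N$; $q_n$ and $d_{m,n}$ are deterministic and may depend on $N$. Bounded variance profile: $\sup_N\max_{m,n} q_n d_{m,n}<\infty$. $\mathbb{R}_{++}$ denotes the positive reals; sums over $n\neq m$ run over $n\in\{1,\dots,JK\}\setminus\{m\}$. *)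

theory Defs
  imports "HOL-Probability.Probability" "Jordan_Normal_Form.Gauss_Jordan_Elimination"
begin

no_notation inner (infix "\<bullet>" 70)
no_notation vec_nth (infixl "$" 90)

text \<open>The pair \<open>(j, k)\<close> is user \<open>k\<close> of cell \<open>j\<close>; both are counted from 1.  The serial number of this
  user is \<open>(j - 1) * K + k\<close>, which for fixed \<open>(j, k)\<close> varies with \<open>K\<close>.\<close>

type_synonym user = "nat \<times> nat"

definition users :: "nat \<Rightarrow> nat \<Rightarrow> user set" where
  "users J K = {1..J} \<times> {1..K}"

text \<open>The distribution CN(0,1): independent real and imaginary parts, each normal with mean 0 and
  variance 1/2.\<close>

definition std_complex_normal :: "'a measure \<Rightarrow> ('a \<Rightarrow> complex) \<Rightarrow> bool" where
  "std_complex_normal M X \<longleftrightarrow>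
     prob_space.indep_var M borel (\<lambda>\<omega>. Re (X \<omega>)) borel (\<lambda>\<omega>. Im (X \<omega>)) \<and>
     distributed M lborel (\<lambda>\<omega>. Re (X \<omega>)) (normal_density 0 (1 / sqrt 2)) \<and>
     distributed M lborel (\<lambda>\<omega>. Im (X \<omega>)) (normal_density 0 (1 / sqrt 2))"

text \<open>Channel vectors \<open>h b n\<close> and coefficients \<open>d b n\<close> are indexed by the base station \<open>b\<close> and the user
  \<open>n\<close>; the base station serving user \<open>m\<close> is \<open>fst m\<close>.  The \<open>(i, l)\<close> entry of the outer product of
  \<open>v\<close> with its conjugate transpose is \<open>v $ i * cnj (v $ l)\<close>.\<close>

definition interference_matrix ::
  "nat \<Rightarrow> user set \<Rightarrow> (nat \<Rightarrow> user \<Rightarrow> real) \<Rightarrow> (user \<Rightarrow> real) \<Rightarrow> (user \<Rightarrow> real) \<Rightarrow>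
   (nat \<Rightarrow> user \<Rightarrow> complex vec) \<Rightarrow> user \<Rightarrow> complex mat" where
  "interference_matrix N U d w q h m =
     mat N N (\<lambda>(i, l). \<Sum>n\<in>U - {m}.
       complex_of_real (q n * d (fst m) n / real N) * (h (fst m) n $ i * cnj (h (fst m) n $ l)))
     + complex_of_real (w m) \<cdot>\<^sub>m 1\<^sub>m N"

text \<open>\<open>mat_inverse\<close> is an option; the matrix above is positive definite whenever \<open>w m > 0\<close> and the
  coefficients are nonnegative, so it is then invertible.  The value below is complex-typed, although
  it is in fact real.\<close>

definition SINR_DN ::
  "nat \<Rightarrow> user set \<Rightarrow> (nat \<Rightarrow> user \<Rightarrow> real) \<Rightarrow> (user \<Rightarrow> real) \<Rightarrow> (user \<Rightarrow> real) \<Rightarrow>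
   (nat \<Rightarrow> user \<Rightarrow> complex vec) \<Rightarrow> user \<Rightarrow> complex" where
  "SINR_DN N U d w q h m =
     complex_of_real (q m * d (fst m) m / real N) *
     ((the (mat_inverse (interference_matrix N U d w q h m)) *\<^sub>v h (fst m) m) \<bullet>c h (fst m) m)"

definition fixed_point_rhs ::
  "nat \<Rightarrow> user set \<Rightarrow> (nat \<Rightarrow> user \<Rightarrow> real) \<Rightarrow> (user \<Rightarrow> real) \<Rightarrow> (user \<Rightarrow> real) \<Rightarrow>
   user \<Rightarrow> real \<Rightarrow> real" where
  "fixed_point_rhs N U d w q m x =
     (q m * d (fst m) m) /
     (w m + (1 / real N) * (\<Sum>n\<in>U - {m}.
        (q n * q m * d (fst m) n * d (fst m) m) /
        (q m * d (fst m) m + q n * d (fst m) n * x)))"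

end

theory Submission
  imports Defs "Jordan_Normal_Form.Determinant"
begin

text \<open>Fix the user \<open>m\<close>, write \<open>a n = q n * d (fst m) n\<close>, let \<open>A\<close> be the interference matrix, \<open>w = w m\<close>, and
  let \<open>A n\<close> be \<open>A\<close> without the term of user \<open>n\<close>.  With \<open>t = tr (inverse A) / N\<close>, the identity
  \<open>tr (A * inverse A) = N\<close> and the Sherman-Morrison formula give
  \<open>w * t + (\<Sum>n. a n * s n / (1 + a n * s n)) / N = 1\<close> exactly, where
  \<open>s n = h n\<^sup>* inverse (A n) h n / N\<close>.  As \<open>h n\<close> is independent of \<open>A n\<close>, the fourth moment of
  \<open>s n - tr (inverse (A n)) / N\<close> is of order \<open>1 / N\<^sup>2\<close>: revealing the entries of \<open>h n\<close> one at a time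
  writes the centred quadratic form as a sum of martingale differences.  The traces of
  \<open>inverse (A n)\<close> and \<open>inverse A\<close> differ by at most \<open>1 / w\<close>, so \<open>t\<close> almost solves \<open>w * t + (\<Sum>n. a n * t / (1 + a n * t)) / N = 1\<close>, whose left-hand side
  has slope at least \<open>w\<close>; hence \<open>t\<close>, and with it \<open>s m\<close>, is close to the solution \<open>\<beta>\<close>, and
  \<open>a m * \<beta>\<close> solves the fixed-point equation.  The fourth moments of the error are summable
  in \<open>N\<close>, which gives almost sure convergence.\<close>

section \<open>Regularised Gram matrices and their inverses\<close>

text \<open>Second moments of the error would be of order \<open>1 / N\<close>, which is not
  summable; fourth moments give \<open>1 / N\<^sup>2\<close>, which is why they are carried
  throughout. The trace \<open>t\<close> is itself random, yet its concentration around a mean is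
  never proved: the trace identity holds for each outcome, so the comparison with the deterministic
  \<beta> is pathwise, and probability enters only through the deviations of quadratic forms from
  traces. Invertibility and all bounds on inverses rest on coercivity with constant
  \<open>w\<close>, which holds for every set of columns and so survives the removal of a user.
  Vectors are functions on \<open>nat\<close> of which only the values below \<open>N\<close> count.
  The matrix library supplies the inverse and, through the adjugate, its measurability; the
  estimates themselves are made on linear maps.\<close>

definition cip :: "nat \<Rightarrow> (nat \<Rightarrow> complex) \<Rightarrow> (nat \<Rightarrow> complex) \<Rightarrow> complex" where
  "cip N x y = (\<Sum>k<N. cnj (x k) * y k)"

definition sqn :: "nat \<Rightarrow> (nat \<Rightarrow> complex) \<Rightarrow> real" where
  "sqn N x = (\<Sum>k<N. (cmod (x k))\<^sup>2)"

definition unitv :: "nat \<Rightarrow> nat \<Rightarrow> complex" where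
  "unitv l i = (if i = l then 1 else 0)"

section \<open>The Hermitian inner product, conjugate-linear in its first argument\<close>

lemma cip_add: "cip N x (\<lambda>i. u i + v i) = cip N x u + cip N x v"
  by (simp add: cip_def sum.distrib algebra_simps)

lemma cip_diff: "cip N x (\<lambda>i. u i - v i) = cip N x u - cip N x v"
  by (simp add: cip_def sum_subtractf algebra_simps)

lemma cip_scale: "cip N x (\<lambda>i. a * u i) = a * cip N x u"
  by (simp add: cip_def sum_distrib_left algebra_simps)

lemma cip_sum: "cip N x (\<lambda>i. \<Sum>j\<in>A. u j i) = (\<Sum>j\<in>A. cip N x (u j))"
  unfolding cip_def sum_distrib_left by (rule sum.swap)

lemma cnj_cip: "cnj (cip N x y) = cip N y x"
  by (simp add: cip_def mult.commute)

lemma cip_cong: "(\<And>i. i < N \<Longrightarrow> x i = x' i) \<Longrightarrow> (\<And>i. i < N \<Longrightarrow> y i = y' i) \<Longrightarrow> cip N x y = cip N x' y'"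
  by (simp add: cip_def)

lemma cip_unitv: "l < N \<Longrightarrow> cip N x (unitv l) = cnj (x l)"
proof -
  assume "l < N"
  have "cip N x (unitv l) = (\<Sum>k<N. if k = l then cnj (x l) else 0)"
    unfolding cip_def unitv_def by (rule sum.cong) auto
  also have "\<dots> = cnj (x l)" using \<open>l < N\<close> by simp
  finally show ?thesis .
qed

lemma cip_self: "cip N x x = of_real (sqn N x)"
  by (simp add: cip_def sqn_def complex_norm_square mult.commute del: of_real_power)

lemma sqn_nonneg: "0 \<le> sqn N x"
  by (simp add: sqn_def sum_nonneg)

lemma sqn_eq_0: "sqn N x = 0 \<longleftrightarrow> (\<forall>i<N. x i = 0)"
  by (auto simp: sqn_def sum_nonneg_eq_0_iff)

definition ridge_entry ::
  "real \<Rightarrow> ('b \<Rightarrow> real) \<Rightarrow> ('b \<Rightarrow> nat \<Rightarrow> complex) \<Rightarrow> 'b set \<Rightarrow> nat \<Rightarrow> nat \<Rightarrow> complex" where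
  "ridge_entry w c h S i l =
     (\<Sum>n\<in>S. complex_of_real (c n) * (h n i * cnj (h n l))) + (if i = l then of_real w else 0)"

definition ridge_mat ::
  "nat \<Rightarrow> real \<Rightarrow> ('b \<Rightarrow> real) \<Rightarrow> ('b \<Rightarrow> nat \<Rightarrow> complex) \<Rightarrow> 'b set \<Rightarrow> complex mat" where
  "ridge_mat N w c h S = mat N N (\<lambda>(i, l). ridge_entry w c h S i l)"

definition ridge_inv ::
  "nat \<Rightarrow> real \<Rightarrow> ('b \<Rightarrow> real) \<Rightarrow> ('b \<Rightarrow> nat \<Rightarrow> complex) \<Rightarrow> 'b set \<Rightarrow> nat \<Rightarrow> nat \<Rightarrow> complex" where
  "ridge_inv N w c h S i l = the (mat_inverse (ridge_mat N w c h S)) $$ (i, l)"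

text \<open>Real parts make traces and forms real-typed; under the assumptions of
  \<open>ridge\<close> below the inverse is Hermitian, so nothing is lost.\<close>

definition ridge_trace ::
  "nat \<Rightarrow> real \<Rightarrow> ('b \<Rightarrow> real) \<Rightarrow> ('b \<Rightarrow> nat \<Rightarrow> complex) \<Rightarrow> 'b set \<Rightarrow> real" where
  "ridge_trace N w c h S = (\<Sum>l<N. Re (ridge_inv N w c h S l l))"

definition ridge_form ::
  "nat \<Rightarrow> real \<Rightarrow> ('b \<Rightarrow> real) \<Rightarrow> ('b \<Rightarrow> nat \<Rightarrow> complex) \<Rightarrow> 'b set \<Rightarrow> (nat \<Rightarrow> complex) \<Rightarrow> real" where
  "ridge_form N w c h S x =
     Re (\<Sum>i<N. \<Sum>j<N. cnj (x i) * ridge_inv N w c h S i j * x j)"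

text \<open>\<open>T\<close> is an ambient set of columns while \<open>S \<subseteq> T\<close>
  varies in the lemmas, so that a matrix and its versions with one column removed live in the same
  locale. In the application \<open>c n\<close> is \<open>a n / N\<close>.\<close>

locale ridge =
  fixes N :: nat and w :: real and c :: "'b \<Rightarrow> real" and h :: "'b \<Rightarrow> nat \<Rightarrow> complex" and T :: "'b set"
  assumes w_pos: "w > 0" and fin_T: "finite T" and c_nonneg: "\<And>n. n \<in> T \<Longrightarrow> 0 \<le> c n"
begin

text \<open>\<open>rop S u\<close> is the action on \<open>u\<close> of the matrix with entries \<open>ridge_entry w c h S\<close>; only indices
  below \<open>N\<close> are meaningful.\<close>

definition rop :: "'b set \<Rightarrow> (nat \<Rightarrow> complex) \<Rightarrow> nat \<Rightarrow> complex" where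
  "rop S u i = of_real w * u i + (\<Sum>n\<in>S. of_real (c n) * (h n i * cip N (h n) u))"

abbreviation "B \<equiv> ridge_inv N w c h"

text \<open>Multiplication by the inverse, seen as the solution operator of
  \<open>rop S u = x\<close>: identities for the inverse are checked by applying \<open>rop\<close>,
  which is injective.\<close>

definition sol :: "'b set \<Rightarrow> (nat \<Rightarrow> complex) \<Rightarrow> nat \<Rightarrow> complex" where
  "sol S x i = (\<Sum>l<N. B S i l * x l)"

lemma rop_entry:
  assumes "i < N"
  shows "(\<Sum>l<N. ridge_entry w c h S i l * u l) = rop S u i"
proof -
  have "(\<Sum>l<N. ridge_entry w c h S i l * u l) =
      (\<Sum>l<N. \<Sum>n\<in>S. of_real (c n) * (h n i * (cnj (h n l) * u l))) + (\<Sum>l<N. if i = l then of_real w * u l else 0)"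
    unfolding ridge_entry_def sum.distrib[symmetric] distrib_right sum_distrib_right
    by (rule sum.cong) (auto simp: mult.assoc)
  also have "(\<Sum>l<N. if i = l then of_real w * u l else 0) = of_real w * u i"
    using assms by simp
  also have "(\<Sum>l<N. \<Sum>n\<in>S. of_real (c n) * (h n i * (cnj (h n l) * u l))) = (\<Sum>n\<in>S. of_real (c n) * (h n i * cip N (h n) u))"
    unfolding cip_def sum_distrib_left by (rule sum.swap)
  finally show ?thesis by (simp add: rop_def)
qed

lemma rop_diff: "rop S (\<lambda>i. u i - v i) i = rop S u i - rop S v i"
  by (simp add: rop_def cip_diff algebra_simps sum_subtractf)

lemma rop_scale: "rop S (\<lambda>i. a * u i) i = a * rop S u i"
  by (simp add: rop_def cip_scale algebra_simps sum_distrib_left)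

lemma cip_rop: "cip N x (rop S u) =
    of_real w * cip N x u + (\<Sum>n\<in>S. of_real (c n) * (cip N x (h n) * cip N (h n) u))"
proof -
  have "cip N x (rop S u) = cip N x (\<lambda>i. of_real w * u i + (\<Sum>n\<in>S. (of_real (c n) * cip N (h n) u) * h n i))"
    by (rule cip_cong) (auto simp: rop_def mult_ac)
  also have "\<dots> = of_real w * cip N x u + (\<Sum>n\<in>S. (of_real (c n) * cip N (h n) u) * cip N x (h n))"
    by (simp only: cip_add cip_scale cip_sum)
  finally show ?thesis by (simp add: mult_ac)
qed

lemma cip_rop_sym: "cip N (rop S x) y = cip N x (rop S y)"
proof -
  have "cip N (rop S x) y = cnj (cip N y (rop S x))" by (simp add: cnj_cip)
  also have "\<dots> = cip N x (rop S y)"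
    unfolding cip_rop by (simp add: cnj_cip mult_ac)
  finally show ?thesis .
qed

section \<open>Coercivity and invertibility\<close>

lemma cip_rop_self:
  "cip N u (rop S u) = of_real (w * sqn N u + (\<Sum>n\<in>S. c n * (cmod (cip N (h n) u))\<^sup>2))"
proof -
  have "cip N u (h n) * cip N (h n) u = of_real ((cmod (cip N (h n) u))\<^sup>2)" for n
    unfolding cnj_cip[of N "h n" u, symmetric]
    by (simp add: complex_norm_square mult.commute del: of_real_power)
  then show ?thesis unfolding cip_rop cip_self by simp
qed

text \<open>The Gram part adds nonnegative squares, so the matrix dominates \<open>w\<close> times
  the identity. Every \<open>1 / w\<close> in the estimates of the inverse comes from here.\<close>

lemma cip_rop_self_ge:
  assumes "S \<subseteq> T"
  shows "w * sqn N u \<le> Re (cip N u (rop S u))" "Im (cip N u (rop S u)) = 0"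
  using assms c_nonneg unfolding cip_rop_self by (auto intro!: sum_nonneg)

lemma rop_eq_0:
  assumes "S \<subseteq> T" "\<And>i. i < N \<Longrightarrow> rop S u i = 0" "i < N"
  shows "u i = 0"
proof -
  have "cip N u (rop S u) = 0" using assms(2) by (simp add: cip_def)
  then have "w * sqn N u \<le> 0" using cip_rop_self_ge[OF assms(1), of u] by simp
  then have "sqn N u \<le> 0" using w_pos by (simp add: mult_le_0_iff)
  then have "sqn N u = 0" using sqn_nonneg[of N u] by linarith
  then show ?thesis using assms(3) by (simp add: sqn_eq_0)
qed

lemma rop_inj:
  assumes "S \<subseteq> T" "\<And>i. i < N \<Longrightarrow> rop S u i = rop S v i" "i < N"
  shows "u i = v i"
  using rop_eq_0[OF assms(1), of "\<lambda>i. u i - v i"] assms(2,3) by (simp add: rop_diff)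

lemma ridge_mat_carrier: "ridge_mat N w c h S \<in> carrier_mat N N"
  by (simp add: ridge_mat_def)

lemma det_ridge_mat:
  assumes "S \<subseteq> T"
  shows "Determinant.det (ridge_mat N w c h S) \<noteq> 0"
proof
  assume "Determinant.det (ridge_mat N w c h S) = 0"
  then obtain v where v: "v \<in> carrier_vec N" "v \<noteq> 0\<^sub>v N" "ridge_mat N w c h S *\<^sub>v v = 0\<^sub>v N"
    using det_0_iff_vec_prod_zero[OF ridge_mat_carrier] by blast
  have "v $ i = 0" if "i < N" for i
  proof (rule rop_eq_0[OF assms _ that, of "\<lambda>i. v $ i"])
    fix j assume j: "j < N"
    have "(ridge_mat N w c h S *\<^sub>v v) $ j = (\<Sum>l<N. ridge_entry w c h S j l * v $ l)"
      using v(1) j by (simp add: ridge_mat_def scalar_prod_def lessThan_atLeast0)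
    then show "rop S (\<lambda>i. v $ i) j = 0" using v(3) j by (simp add: rop_entry)
  qed
  then have "v = 0\<^sub>v N" using v(1) by (intro eq_vecI) auto
  with v(2) show False by simp
qed

lemma ridge_mat_inverse:
  assumes "S \<subseteq> T"
  obtains R where "mat_inverse (ridge_mat N w c h S) = Some R" "R \<in> carrier_mat N N"
    "ridge_mat N w c h S * R = 1\<^sub>m N" "R * ridge_mat N w c h S = 1\<^sub>m N"
proof -
  let ?A = "ridge_mat N w c h S"
  have "?A \<in> Units (ring_mat TYPE(complex) N ())"
    using det_non_zero_imp_unit[OF ridge_mat_carrier det_ridge_mat[OF assms]] .
  then obtain R where "mat_inverse ?A = Some R"
    using mat_inverse(1)[OF ridge_mat_carrier, of S "()"] by (cases "mat_inverse ?A") auto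
  with mat_inverse(2)[OF ridge_mat_carrier this] that show ?thesis by blast
qed

text \<open>Cramer's rule. \<open>mat_inverse\<close> is computed by elimination, whose case
  distinctions hide how the result depends on the entries; determinants are polynomials in them,
  which gives measurability.\<close>

lemma ridge_inv_adj:
  assumes "S \<subseteq> T" "i < N" "l < N"
  shows "B S i l = adj_mat (ridge_mat N w c h S) $$ (i, l) / Determinant.det (ridge_mat N w c h S)"
proof -
  let ?A = "ridge_mat N w c h S"
  obtain R where R: "mat_inverse ?A = Some R" "R \<in> carrier_mat N N" "R * ?A = 1\<^sub>m N"
    using ridge_mat_inverse[OF assms(1)] by metis
  note adj = adj_mat[OF ridge_mat_carrier[of S]]
  have "adj_mat ?A = R * ?A * adj_mat ?A" using R(3) adj(1) by simp
  also have "\<dots> = R * (Determinant.det ?A \<cdot>\<^sub>m 1\<^sub>m N)"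
    using assoc_mult_mat[OF R(2) ridge_mat_carrier adj(1)] adj(2) by simp
  also have "\<dots> = Determinant.det ?A \<cdot>\<^sub>m R" using R(2) mult_smult_distrib[OF R(2) one_carrier_mat, of "Determinant.det ?A"] by simp
  finally have "adj_mat ?A $$ (i, l) = Determinant.det ?A * R $$ (i, l)" using assms R(2) by simp
  then show ?thesis using det_ridge_mat[OF assms(1)] R(1) by (simp add: ridge_inv_def)
qed

lemma rop_ridge_inv:
  assumes "S \<subseteq> T" "i < N" "l < N"
  shows "rop S (\<lambda>k. B S k l) i = unitv l i"
proof -
  let ?A = "ridge_mat N w c h S"
  obtain R where R: "mat_inverse ?A = Some R" "R \<in> carrier_mat N N" "?A * R = 1\<^sub>m N"
    using ridge_mat_inverse[OF assms(1)] by metis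
  have "(?A * R) $$ (i, l) = (\<Sum>k<N. ridge_entry w c h S i k * R $$ (k, l))"
    using R(2) assms by (simp add: ridge_mat_def scalar_prod_def lessThan_atLeast0)
  also have "\<dots> = rop S (\<lambda>k. B S k l) i"
    using R(1) assms by (simp add: rop_entry[symmetric] ridge_inv_def)
  finally show ?thesis using R(3) assms by (simp add: unitv_def)
qed

lemma rop_sol:
  assumes "S \<subseteq> T" "i < N"
  shows "rop S (sol S x) i = x i"
proof -
  have "rop S (sol S x) i = (\<Sum>l<N. x l * rop S (\<lambda>k. B S k l) i)"
    unfolding rop_def sol_def cip_sum
    by (simp add: sum_distrib_left sum.distrib algebra_simps cip_scale sum.swap[of _ S "{..<N}"])
  also have "\<dots> = (\<Sum>l<N. if l = i then x i else 0)"
    using assms by (intro sum.cong) (auto simp: rop_ridge_inv unitv_def)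
  also have "\<dots> = x i" using assms by simp
  finally show ?thesis .
qed

lemma sol_eqI:
  assumes "S \<subseteq> T" "\<And>i. i < N \<Longrightarrow> rop S u i = x i" "i < N"
  shows "sol S x i = u i"
  by (rule rop_inj[OF assms(1) _ assms(3)]) (simp add: rop_sol assms)

section \<open>Self-adjointness and size of the inverse\<close>

lemma cip_sol_sym:
  assumes "S \<subseteq> T"
  shows "cip N (sol S x) y = cip N x (sol S y)"
proof -
  have "cip N (sol S x) y = cip N (sol S x) (rop S (sol S y))"
    using assms by (intro cip_cong) (auto simp: rop_sol)
  also have "\<dots> = cip N (rop S (sol S x)) (sol S y)" by (simp add: cip_rop_sym)
  also have "\<dots> = cip N x (sol S y)" using assms by (intro cip_cong) (auto simp: rop_sol)
  finally show ?thesis .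
qed

text \<open>For \<open>u = sol S x\<close> the form equals \<open>cip N u (rop S u)\<close>, to
  which coercivity applies. This is more than nonnegativity: the form controls the squared norm of
  the solution.\<close>

lemma cip_sol_self:
  assumes "S \<subseteq> T"
  shows "w * sqn N (sol S x) \<le> Re (cip N x (sol S x))" "Im (cip N x (sol S x)) = 0"
proof -
  have "cip N x (sol S x) = cip N (sol S x) (rop S (sol S x))"
    unfolding cip_rop_sym[symmetric] using assms by (intro cip_cong) (auto simp: rop_sol)
  then show "w * sqn N (sol S x) \<le> Re (cip N x (sol S x))" "Im (cip N x (sol S x)) = 0"
    using cip_rop_self_ge[OF assms, of "sol S x"] by simp_all
qed

lemma sol_unitv: "l < N \<Longrightarrow> sol S (unitv l) i = B S i l"
proof -
  assume "l < N"
  have "sol S (unitv l) i = (\<Sum>k<N. if k = l then B S i l else 0)"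
    unfolding sol_def unitv_def by (rule sum.cong) auto
  then show ?thesis using \<open>l < N\<close> by simp
qed

lemma ridge_inv_hermitian:
  assumes "S \<subseteq> T" "k < N" "l < N"
  shows "B S k l = cnj (B S l k)"
  using cip_sol_sym[OF assms(1), of "unitv k" "unitv l"] cnj_cip[of N "sol S (unitv l)" "unitv k"]
    cip_unitv[of k N "sol S (unitv l)"] cip_unitv[of l N "sol S (unitv k)"] assms
  by (simp add: sol_unitv)

text \<open>If \<open>s\<close> is the squared norm of column \<open>i\<close>, then
  \<open>w * s \<le> Re (B S i i)\<close>, and one entry is at most the norm of its column, so
  \<open>(w * s)\<^sup>2 \<le> s\<close>. This takes the place of an operator norm bound; by
  Hermitian symmetry the row has the norm of the column.\<close>

lemma ridge_inv_row:
  assumes "S \<subseteq> T" "i < N"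
  shows "(\<Sum>j<N. (cmod (B S i j))\<^sup>2) \<le> (1 / w)\<^sup>2"
proof -
  define s where "s = sqn N (sol S (unitv i))"
  have "w * s \<le> Re (cip N (unitv i) (sol S (unitv i)))"
    unfolding s_def by (rule cip_sol_self(1)[OF assms(1)])
  also have "\<dots> = Re (B S i i)"
    using cnj_cip[of N "sol S (unitv i)" "unitv i"] cip_unitv[OF assms(2), of "sol S (unitv i)"]
    assms by (simp add: sol_unitv)
  also have "\<dots> \<le> cmod (B S i i)" by (rule complex_Re_le_cmod)
  finally have "(w * s)\<^sup>2 \<le> (cmod (B S i i))\<^sup>2"
    using w_pos sqn_nonneg[of N "sol S (unitv i)"] by (intro power_mono) (auto simp: s_def)
  also have "\<dots> \<le> s"
    unfolding s_def sqn_def sol_unitv[OF assms(2)]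
    by (rule member_le_sum[of i _ "\<lambda>k. (cmod (B S k i))\<^sup>2"]) (use assms in auto)
  finally have "s * (w\<^sup>2 * s) \<le> s * 1" by (simp add: power2_eq_square mult_ac)
  then have "w\<^sup>2 * s \<le> 1 \<or> s = 0"
    using sqn_nonneg[of N "sol S (unitv i)", folded s_def]
    by (cases "s = 0") (auto simp: mult_le_cancel_left)
  then have "s \<le> (1 / w)\<^sup>2" using w_pos by (auto simp: field_simps power2_eq_square)
  moreover have "(\<Sum>j<N. (cmod (B S i j))\<^sup>2) = s"
    unfolding s_def sqn_def
    by (rule sum.cong[OF refl]) (use assms in \<open>simp add: sol_unitv ridge_inv_hermitian[of S i]\<close>)
  ultimately show ?thesis by simp
qed

lemma ridge_form_sol: "ridge_form N w c h S x = Re (cip N x (sol S x))"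
  by (simp add: ridge_form_def cip_def sol_def sum_distrib_left mult.assoc)

lemma ridge_form_nonneg: "S \<subseteq> T \<Longrightarrow> 0 \<le> ridge_form N w c h S x"
  using cip_sol_self(1)[of S x] mult_nonneg_nonneg[of w "sqn N (sol S x)"] w_pos sqn_nonneg[of N "sol S x"]
  unfolding ridge_form_sol by linarith

lemma cip_sol_eq_ridge_form: "S \<subseteq> T \<Longrightarrow> cip N x (sol S x) = of_real (ridge_form N w c h S x)"
  using cip_sol_self(2)[of S x] by (simp add: ridge_form_sol complex_eq_iff)

section \<open>Rank-one updates\<close>

lemma rop_insert:
  assumes "n \<notin> S" "insert n S \<subseteq> T"
  shows "rop (insert n S) u i = rop S u i + of_real (c n) * (h n i * cip N (h n) u)"
  using assms finite_subset[OF _ fin_T, of S] by (simp add: rop_def)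

lemma sherman_morrison:
  assumes "n \<notin> S" "insert n S \<subseteq> T" "i < N"
  defines "y \<equiv> ridge_form N w c h S (h n)"
  shows "sol (insert n S) x i = sol S x i - of_real (c n / (1 + c n * y)) * cip N (sol S (h n)) x * sol S (h n) i"
proof (rule sol_eqI[OF assms(2) _ assms(3)])
  fix i assume i: "i < N"
  have S: "S \<subseteq> T" using assms by simp
  have pos: "1 + c n * y > 0"
    using ridge_form_nonneg[OF S] c_nonneg[of n] assms by (simp add: add_pos_nonneg)
  \<comment> \<open>This coefficient makes the multiple of \<open>h n\<close> that is left over
    after applying the updated map vanish.\<close>
  define a where "a = of_real (c n / (1 + c n * y)) * cip N (sol S (h n)) x"
  have a: "a * (1 + of_real (c n * y)) = of_real (c n) * cip N (sol S (h n)) x"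
  proof -
    have "a * (1 + of_real (c n * y)) = of_real (c n / (1 + c n * y) * (1 + c n * y)) * cip N (sol S (h n)) x"
      by (simp only: a_def of_real_mult of_real_add of_real_1 mult_ac)
    also have "c n / (1 + c n * y) * (1 + c n * y) = c n" using pos by simp
    finally show ?thesis .
  qed
  have 1: "cip N (h n) (\<lambda>i. sol S x i - a * sol S (h n) i) = cip N (sol S (h n)) x - a * of_real y"
    using cip_sol_sym[OF S, of "h n" x] cip_sol_eq_ridge_form[OF S, of "h n"]
    by (simp add: cip_diff cip_scale y_def)
  have "rop (insert n S) (\<lambda>i. sol S x i - a * sol S (h n) i) i =
      x i - a * h n i + of_real (c n) * (h n i * (cip N (sol S (h n)) x - a * of_real y))"
    unfolding rop_insert[OF assms(1,2)] unfolding 1 rop_diff rop_scale using i S by (simp add: rop_sol)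
  also have "\<dots> = x i + h n i * (of_real (c n) * cip N (sol S (h n)) x - a * (1 + of_real (c n * y)))"
    by (simp add: algebra_simps)
  also have "\<dots> = x i" unfolding a by simp
  finally show "rop (insert n S) (\<lambda>i. sol S x i - of_real (c n / (1 + c n * y)) * cip N (sol S (h n)) x * sol S (h n) i) i = x i"
    unfolding a_def .
qed

text \<open>Expresses a form whose matrix contains \<open>h n\<close> through one whose matrix does
  not; the saturating fraction in the fixed-point equation originates here.\<close>

lemma ridge_form_insert:
  assumes "n \<notin> S" "insert n S \<subseteq> T"
  defines "y \<equiv> ridge_form N w c h S (h n)"
  shows "ridge_form N w c h (insert n S) (h n) = y / (1 + c n * y)"
proof -
  have S: "S \<subseteq> T" using assms by simp
  have pos: "1 + c n * y > 0"
    using ridge_form_nonneg[OF S] c_nonneg[of n] assms by (simp add: add_pos_nonneg)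
  have y: "cip N (h n) (sol S (h n)) = of_real y" "cip N (sol S (h n)) (h n) = of_real y"
    using cip_sol_eq_ridge_form[OF S, of "h n"] cip_sol_sym[OF S] by (simp_all add: y_def)
  have "cip N (h n) (sol (insert n S) (h n)) =
      cip N (h n) (\<lambda>i. sol S (h n) i - of_real (c n / (1 + c n * y)) * cip N (sol S (h n)) (h n) * sol S (h n) i)"
    by (rule cip_cong) (use sherman_morrison[OF assms(1,2)] in \<open>auto simp: y_def\<close>)
  also have "\<dots> = of_real (y - c n / (1 + c n * y) * y * y)"
    unfolding cip_diff cip_scale y by simp
  also have "y - c n / (1 + c n * y) * y * y = y / (1 + c n * y)"
    using pos by (simp add: field_simps)
  finally show ?thesis by (simp add: ridge_form_sol)
qed

text \<open>The rank-one correction has trace \<open>c n * s / (1 + c n * y)\<close>, where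
  \<open>y\<close> is the form at \<open>h n\<close> and \<open>s\<close> the squared norm of
  \<open>sol S (h n)\<close>; as \<open>w * s \<le> y\<close>, it is at most \<open>1 / w\<close>
  however long \<open>h n\<close> is.\<close>

lemma ridge_trace_insert:
  assumes "n \<notin> S" "insert n S \<subseteq> T"
  shows "\<bar>ridge_trace N w c h (insert n S) - ridge_trace N w c h S\<bar> \<le> 1 / w"
proof -
  define y where "y = ridge_form N w c h S (h n)"
  define s where "s = sqn N (sol S (h n))"
  have S: "S \<subseteq> T" using assms by simp
  have y: "0 \<le> y" "w * s \<le> y" and cn: "0 \<le> c n"
    using ridge_form_nonneg[OF S] cip_sol_self(1)[OF S, of "h n"] c_nonneg[of n] assms
    by (simp_all add: y_def s_def ridge_form_sol)
  then have pos: "1 + c n * y > 0" by (simp add: add_pos_nonneg)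
  have "B (insert n S) l l = B S l l - of_real (c n / (1 + c n * y) * (cmod (sol S (h n) l))\<^sup>2)" if "l < N" for l
  proof -
    have "cip N (sol S (h n)) (unitv l) * sol S (h n) l = of_real ((cmod (sol S (h n) l))\<^sup>2)"
      using that by (simp add: cip_unitv complex_norm_square mult.commute del: of_real_power)
    then show ?thesis
      using sherman_morrison[OF assms that, of "unitv l"] that
      by (simp add: sol_unitv y_def mult.assoc)
  qed
  then have "ridge_trace N w c h (insert n S) = ridge_trace N w c h S - c n / (1 + c n * y) * s"
    unfolding ridge_trace_def s_def sqn_def sum_distrib_left by (simp add: sum_subtractf)
  moreover have "0 \<le> c n / (1 + c n * y) * s" using pos cn sqn_nonneg by (simp add: s_def)
  moreover have "c n / (1 + c n * y) * s \<le> 1 / w"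
  proof -
    have "c n * (w * s) \<le> c n * y" using y cn by (intro mult_left_mono)
    then have "c n * s * w \<le> 1 + c n * y" by (simp add: mult_ac)
    then show ?thesis using pos w_pos by (simp add: field_simps)
  qed
  ultimately show ?thesis by linarith
qed

lemma ridge_trace_identity:
  assumes "S \<subseteq> T"
  shows "w * ridge_trace N w c h S + (\<Sum>n\<in>S. c n * ridge_form N w c h S (h n)) = N"
proof -
  have "(\<Sum>l<N. rop S (\<lambda>k. B S k l) l) = (\<Sum>l<N. 1)"
    by (rule sum.cong) (auto simp: rop_ridge_inv[OF assms] unitv_def)
  then have "of_nat N = (\<Sum>l<N. rop S (\<lambda>k. B S k l) l)" by simp
  also have "\<dots> = (\<Sum>l<N. of_real w * B S l l) + (\<Sum>n\<in>S. \<Sum>l<N. of_real (c n) * (h n l * cip N (h n) (\<lambda>k. B S k l)))"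
    by (simp add: rop_def sum.distrib sum.swap[of _ S "{..<N}"])
  finally have *: "of_nat N = (\<Sum>l<N. of_real w * B S l l) + (\<Sum>n\<in>S. \<Sum>l<N. of_real (c n) * (h n l * cip N (h n) (\<lambda>k. B S k l)))" .
  have "(\<Sum>l<N. of_real (c n) * (h n l * cip N (h n) (\<lambda>k. B S k l))) =
      of_real (c n * ridge_form N w c h S (h n))" for n
  proof -
    \<comment> \<open>Self-adjointness turns \<open>h n\<close> against column \<open>l\<close> into
      the conjugate of entry \<open>l\<close> of \<open>sol S (h n)\<close>, so the sum over
      \<open>l\<close> becomes the quadratic form.\<close>
    have "cip N (h n) (\<lambda>k. B S k l) = cnj (sol S (h n) l)" if "l < N" for l
    proof -
      have "cip N (h n) (\<lambda>k. B S k l) = cip N (h n) (sol S (unitv l))"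
        using that by (intro cip_cong) (simp_all add: sol_unitv)
      then show ?thesis using cip_sol_sym[OF assms, of "h n" "unitv l"] cip_unitv[OF that] by simp
    qed
    then have "(\<Sum>l<N. of_real (c n) * (h n l * cip N (h n) (\<lambda>k. B S k l))) = of_real (c n) * cip N (sol S (h n)) (h n)"
      by (simp add: cip_def sum_distrib_left mult_ac)
    then show ?thesis using cip_sol_eq_ridge_form[OF assms] cip_sol_sym[OF assms] by simp
  qed
  then have "Re (of_nat N) = Re ((\<Sum>l<N. of_real w * B S l l) + (\<Sum>n\<in>S. of_real (c n * ridge_form N w c h S (h n))))"
    unfolding * by simp
  then show ?thesis by (simp add: ridge_trace_def sum_distrib_left)
qed

lemma ridge_trace_nonneg: "S \<subseteq> T \<Longrightarrow> 0 \<le> ridge_trace N w c h S"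
proof -
  assume S: "S \<subseteq> T"
  have "0 \<le> Re (B S l l)" if "l < N" for l
    using ridge_form_nonneg[OF S, of "unitv l"] that
      cnj_cip[of N "sol S (unitv l)" "unitv l"] cip_unitv[OF that, of "sol S (unitv l)"]
    by (simp add: ridge_form_sol sol_unitv)
  then show ?thesis by (auto simp: ridge_trace_def intro!: sum_nonneg)
qed

end

section \<open>Fourth moments of quadratic forms\<close>

text \<open>Measurability is listed separately because it does not follow from that of the fourth
  power.\<close>

definition mom4 :: "'a measure \<Rightarrow> ('a \<Rightarrow> real) \<Rightarrow> bool" where
  "mom4 M X \<longleftrightarrow> X \<in> borel_measurable M \<and> integrable M (\<lambda>\<omega>. X \<omega> ^ 4)"

lemma pow4_add_le: "(x + y :: real) ^ 4 \<le> 8 * (x ^ 4 + y ^ 4)"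
proof -
  have "(x + y)\<^sup>2 \<le> 2 * (x\<^sup>2 + y\<^sup>2)" using sum_squares_bound[of x y] by (simp add: power2_sum)
  then have "((x + y)\<^sup>2)\<^sup>2 \<le> (2 * (x\<^sup>2 + y\<^sup>2))\<^sup>2" by (intro power_mono) auto
  also have "\<dots> = 4 * (x\<^sup>2 + y\<^sup>2)\<^sup>2" unfolding power_mult_distrib by simp
  also have "(x\<^sup>2 + y\<^sup>2)\<^sup>2 \<le> 2 * ((x\<^sup>2)\<^sup>2 + (y\<^sup>2)\<^sup>2)" using sum_squares_bound[of "x\<^sup>2" "y\<^sup>2"] by (simp add: power2_sum)
  finally show ?thesis by simp
qed

text \<open>Here and in the next lemma the constants are generous: both bounds only provide
  integrability.\<close>

lemma abs_cube_mult_le: "\<bar>x ^ 3 * y\<bar> \<le> x ^ 4 + (y :: real) ^ 4"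
proof -
  have "\<bar>x\<bar> ^ 3 * \<bar>y\<bar> \<le> max \<bar>x\<bar> \<bar>y\<bar> ^ 3 * max \<bar>x\<bar> \<bar>y\<bar>"
    by (intro mult_mono power_mono) auto
  also have "\<dots> = max \<bar>x\<bar> \<bar>y\<bar> ^ 4" by (simp add: power3_eq_cube power4_eq_xxxx)
  also have "\<dots> \<le> \<bar>x\<bar> ^ 4 + \<bar>y\<bar> ^ 4" by (auto simp: max_def)
  finally show ?thesis by (simp add: abs_mult power_abs power_even_abs)
qed

lemma square_mult_square_le: "x\<^sup>2 * y\<^sup>2 \<le> x ^ 4 + (y :: real) ^ 4"
proof -
  have "0 \<le> x\<^sup>2 * y\<^sup>2" by simp
  moreover have "2 * (x\<^sup>2 * y\<^sup>2) \<le> x ^ 4 + y ^ 4"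
    using sum_squares_bound[of "x\<^sup>2" "y\<^sup>2"] by simp
  ultimately show ?thesis by linarith
qed

section \<open>Calculus of functions with integrable fourth power\<close>

lemma mom4_add:
  assumes "mom4 M X" "mom4 M Y"
  shows "mom4 M (\<lambda>\<omega>. X \<omega> + Y \<omega>)"
proof -
  have [measurable]: "X \<in> borel_measurable M" "Y \<in> borel_measurable M"
    using assms by (auto simp: mom4_def)
  have "integrable M (\<lambda>\<omega>. (X \<omega> + Y \<omega>) ^ 4)"
    by (rule Bochner_Integration.integrable_bound[of M "\<lambda>\<omega>. 8 * (X \<omega> ^ 4 + Y \<omega> ^ 4)"])
       (use assms in \<open>auto simp: mom4_def pow4_add_le[unfolded distrib_left]\<close>)
  then show ?thesis by (simp add: mom4_def)
qed

lemma expectation_pow4_add_le: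
  assumes "mom4 M X" "mom4 M Y"
  shows "(\<integral>\<omega>. (X \<omega> + Y \<omega>) ^ 4 \<partial>M) \<le> 8 * ((\<integral>\<omega>. X \<omega> ^ 4 \<partial>M) + (\<integral>\<omega>. Y \<omega> ^ 4 \<partial>M))"
proof -
  have int: "integrable M (\<lambda>\<omega>. X \<omega> ^ 4)" "integrable M (\<lambda>\<omega>. Y \<omega> ^ 4)" "integrable M (\<lambda>\<omega>. (X \<omega> + Y \<omega>) ^ 4)"
    using assms mom4_add[OF assms] by (auto simp: mom4_def)
  have "(\<integral>\<omega>. (X \<omega> + Y \<omega>) ^ 4 \<partial>M) \<le> (\<integral>\<omega>. 8 * (X \<omega> ^ 4 + Y \<omega> ^ 4) \<partial>M)"
    by (rule integral_mono) (use int in \<open>auto simp: pow4_add_le[unfolded distrib_left]\<close>)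
  also have "\<dots> = 8 * ((\<integral>\<omega>. X \<omega> ^ 4 \<partial>M) + (\<integral>\<omega>. Y \<omega> ^ 4 \<partial>M))" using int by simp
  finally show ?thesis .
qed

lemma mom4_cmult: "mom4 M X \<Longrightarrow> mom4 M (\<lambda>\<omega>. a * X \<omega>)"
  unfolding mom4_def by (auto simp: power_mult_distrib)

lemma mom4_zero: "mom4 M (\<lambda>_. 0)"
  unfolding mom4_def by simp

lemma mom4_sum: "(\<And>i. i \<in> A \<Longrightarrow> mom4 M (Z i)) \<Longrightarrow> mom4 M (\<lambda>\<omega>. \<Sum>i\<in>A. Z i \<omega>)"
  by (induction A rule: infinite_finite_induct) (auto simp: mom4_zero intro!: mom4_add)

lemma mom4_cube_mult: "mom4 M X \<Longrightarrow> mom4 M Y \<Longrightarrow> integrable M (\<lambda>\<omega>. X \<omega> ^ 3 * Y \<omega>)"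
  unfolding mom4_def
  by (rule Bochner_Integration.integrable_bound[of M "\<lambda>\<omega>. X \<omega> ^ 4 + Y \<omega> ^ 4"]) (auto simp: abs_cube_mult_le)

lemma mom4_square_square: "mom4 M X \<Longrightarrow> mom4 M Y \<Longrightarrow> integrable M (\<lambda>\<omega>. (X \<omega>)\<^sup>2 * (Y \<omega>)\<^sup>2)"
  unfolding mom4_def
  by (rule Bochner_Integration.integrable_bound[of M "\<lambda>\<omega>. X \<omega> ^ 4 + Y \<omega> ^ 4"]) (auto simp: square_mult_square_le)

text \<open>Cauchy-Schwarz for the squares, with upper bounds in place of the moments. It is
  obtained from the weighted arithmetic-geometric mean inequality with weight
  \<open>c / g\<close>.\<close>

lemma expectation_square_square_le:
  assumes XY: "mom4 M X" "mom4 M Y" and "0 \<le> g" "0 \<le> c"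
    and X: "(\<integral>\<omega>. X \<omega> ^ 4 \<partial>M) \<le> g\<^sup>2" and Y: "(\<integral>\<omega>. Y \<omega> ^ 4 \<partial>M) \<le> c\<^sup>2"
  shows "(\<integral>\<omega>. (X \<omega>)\<^sup>2 * (Y \<omega>)\<^sup>2 \<partial>M) \<le> g * c"
proof (rule field_le_epsilon)
  fix e :: real assume e: "e > 0"
  \<comment> \<open>\<open>g\<close> or \<open>c\<close> may be zero, so both are enlarged by
    \<open>d\<close> to make the weight \<open>C / G\<close> meaningful; \<open>d\<close> is so
    small that the product grows by at most \<open>e\<close>.\<close>
  define d where "d = min 1 (e / (g + c + 1))"
  have gc: "0 < g + c + 1" using assms by simp
  have "0 < e / (g + c + 1)" using e gc by (rule divide_pos_pos)
  then have "0 < d" unfolding d_def by simp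
  moreover have "d \<le> 1" unfolding d_def by (rule min.cobounded1)
  moreover have "d \<le> e / (g + c + 1)" unfolding d_def by (rule min.cobounded2)
  ultimately have d: "0 < d" "d \<le> 1" "d \<le> e / (g + c + 1)" .
  have d3: "d * (g + c + 1) \<le> e" using d(3) by (simp only: pos_le_divide_eq[OF gc])
  define G C where "G = g + d" and "C = c + d"
  have pos: "0 < G" "0 < C" using assms d by (auto simp: G_def C_def)
  have int: "integrable M (\<lambda>\<omega>. X \<omega> ^ 4)" "integrable M (\<lambda>\<omega>. Y \<omega> ^ 4)" using XY by (auto simp: mom4_def)
  have *: "2 * (x\<^sup>2 * y\<^sup>2) \<le> C / G * x ^ 4 + G / C * y ^ 4" for x y
  proof -
    define r where "r = C / G"
    have r: "r > 0" "G / C = 1 / r" using pos by (auto simp: r_def)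
    have "0 \<le> (r * x\<^sup>2 - y\<^sup>2)\<^sup>2" by simp
    also have "\<dots> = r\<^sup>2 * x ^ 4 + y ^ 4 - 2 * r * (x\<^sup>2 * y\<^sup>2)"
      by (simp add: power2_diff power_mult_distrib)
    finally have "2 * (x\<^sup>2 * y\<^sup>2) * r \<le> r\<^sup>2 * x ^ 4 + y ^ 4" by (simp add: mult_ac)
    then have "2 * (x\<^sup>2 * y\<^sup>2) \<le> (r\<^sup>2 * x ^ 4 + y ^ 4) / r" using r(1) by (simp add: pos_le_divide_eq)
    also have "\<dots> = r * x ^ 4 + 1 / r * y ^ 4" using r(1) by (simp add: add_divide_distrib power2_eq_square)
    finally show ?thesis unfolding r(2) r_def .
  qed
  have "(\<integral>\<omega>. 2 * ((X \<omega>)\<^sup>2 * (Y \<omega>)\<^sup>2) \<partial>M) \<le> (\<integral>\<omega>. C / G * X \<omega> ^ 4 + G / C * Y \<omega> ^ 4 \<partial>M)"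
  proof (rule integral_mono)
    show "integrable M (\<lambda>\<omega>. 2 * ((X \<omega>)\<^sup>2 * (Y \<omega>)\<^sup>2))"
      using mom4_square_square[OF XY] by (rule integrable_mult_right)
    show "integrable M (\<lambda>\<omega>. C / G * X \<omega> ^ 4 + G / C * Y \<omega> ^ 4)"
      using int by (intro Bochner_Integration.integrable_add integrable_mult_right)
  qed (rule *)
  also have "\<dots> = C / G * (\<integral>\<omega>. X \<omega> ^ 4 \<partial>M) + G / C * (\<integral>\<omega>. Y \<omega> ^ 4 \<partial>M)"
    using int by simp
  finally have 1: "2 * (\<integral>\<omega>. (X \<omega>)\<^sup>2 * (Y \<omega>)\<^sup>2 \<partial>M) \<le>
    C / G * (\<integral>\<omega>. X \<omega> ^ 4 \<partial>M) + G / C * (\<integral>\<omega>. Y \<omega> ^ 4 \<partial>M)" by simp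
  have "g \<le> G" "c \<le> C" using d(1) by (simp_all add: G_def C_def)
  then have gG: "g\<^sup>2 \<le> G\<^sup>2" "c\<^sup>2 \<le> C\<^sup>2" using assms(3,4) power_mono by blast+
  have "0 \<le> C / G" "0 \<le> G / C" using pos by simp_all
  then have "C / G * (\<integral>\<omega>. X \<omega> ^ 4 \<partial>M) \<le> C / G * G\<^sup>2" "G / C * (\<integral>\<omega>. Y \<omega> ^ 4 \<partial>M) \<le> G / C * C\<^sup>2"
    using order_trans[OF X gG(1)] order_trans[OF Y gG(2)] by (simp_all only: mult_left_mono)
  moreover have "C / G * G\<^sup>2 = G * C" "G / C * C\<^sup>2 = G * C" using pos by (simp_all add: power2_eq_square)
  ultimately have "(\<integral>\<omega>. (X \<omega>)\<^sup>2 * (Y \<omega>)\<^sup>2 \<partial>M) \<le> G * C" using 1 by linarith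
  also have "G * C = g * c + d * (g + c + d)" by (simp add: G_def C_def algebra_simps)
  finally have "(\<integral>\<omega>. (X \<omega>)\<^sup>2 * (Y \<omega>)\<^sup>2 \<partial>M) \<le> g * c + d * (g + c + d)" .
  moreover have "d * (g + c + d) \<le> d * (g + c + 1)" using d by (intro mult_left_mono) auto
  ultimately show "(\<integral>\<omega>. (X \<omega>)\<^sup>2 * (Y \<omega>)\<^sup>2 \<partial>M) \<le> g * c + e" using d3 by linarith
qed

text \<open>The hypothesis \<open>orth\<close> removes the only term of the expansion that is linear
  in \<open>Z\<close>. The bounds are squares so that their roots add up: \<open>g\<close> becomes
  \<open>g + 4 * c\<close>.\<close>

lemma fourth_moment_add:
  assumes SZ: "mom4 M S" "mom4 M Z" and "0 \<le> g" "0 \<le> c"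
    and S: "(\<integral>\<omega>. S \<omega> ^ 4 \<partial>M) \<le> g\<^sup>2" and Z: "(\<integral>\<omega>. Z \<omega> ^ 4 \<partial>M) \<le> c\<^sup>2"
    and orth: "(\<integral>\<omega>. S \<omega> ^ 3 * Z \<omega> \<partial>M) = 0"
  shows "(\<integral>\<omega>. (S \<omega> + Z \<omega>) ^ 4 \<partial>M) \<le> (g + 4 * c)\<^sup>2"
proof -
  have int: "integrable M (\<lambda>\<omega>. S \<omega> ^ 4)" "integrable M (\<lambda>\<omega>. Z \<omega> ^ 4)"
    "integrable M (\<lambda>\<omega>. S \<omega> ^ 3 * Z \<omega>)" "integrable M (\<lambda>\<omega>. (S \<omega>)\<^sup>2 * (Z \<omega>)\<^sup>2)"
    "integrable M (\<lambda>\<omega>. (S \<omega> + Z \<omega>) ^ 4)"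
    using SZ mom4_cube_mult[OF SZ] mom4_square_square[OF SZ] mom4_add[OF SZ] by (auto simp: mom4_def)
  \<comment> \<open>\<open>- 4 * x * z ^ 3\<close> and \<open>4 * x * z ^ 3\<close> are at most
    \<open>2 * x\<^sup>2 * z\<^sup>2 + 2 * z ^ 4\<close>, which raises the binomial coefficients 6
    and 1 to 8 and 3.\<close>
  have "(x + z) ^ 4 \<le> x ^ 4 + 4 * (x ^ 3 * z) + 8 * (x\<^sup>2 * z\<^sup>2) + 3 * z ^ 4" for x z :: real
  proof -
    have "0 \<le> 2 * (z * (x - z))\<^sup>2" by simp
    also have "\<dots> = x ^ 4 + 4 * (x ^ 3 * z) + 8 * (x\<^sup>2 * z\<^sup>2) + 3 * z ^ 4 - (x + z) ^ 4"
      by (simp add: eval_nat_numeral algebra_simps)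
    finally show ?thesis by simp
  qed
  then have "(\<integral>\<omega>. (S \<omega> + Z \<omega>) ^ 4 \<partial>M) \<le>
      (\<integral>\<omega>. S \<omega> ^ 4 + 4 * (S \<omega> ^ 3 * Z \<omega>) + 8 * ((S \<omega>)\<^sup>2 * (Z \<omega>)\<^sup>2) + 3 * Z \<omega> ^ 4 \<partial>M)"
    using int by (intro integral_mono) auto
  also have "\<dots> = (\<integral>\<omega>. S \<omega> ^ 4 \<partial>M) + 8 * (\<integral>\<omega>. (S \<omega>)\<^sup>2 * (Z \<omega>)\<^sup>2 \<partial>M) + 3 * (\<integral>\<omega>. Z \<omega> ^ 4 \<partial>M)"
    using int orth by simp
  also have "\<dots> \<le> g\<^sup>2 + 8 * (g * c) + 3 * c\<^sup>2"
    using expectation_square_square_le[OF SZ assms(3,4) S Z] S Z by linarith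
  \<comment> \<open>The factor 4 is dictated by the mixed term \<open>8 * (g * c)\<close>; the
    square then leaves room for \<open>3 * c\<^sup>2\<close>.\<close>
  also have "\<dots> \<le> (g + 4 * c)\<^sup>2" by (simp add: power2_eq_square algebra_simps)
  finally show ?thesis .
qed

text \<open>A martingale moment inequality that assumes just the orthogonality to cubes of partial
  sums. For equal \<open>c i\<close> the bound is quadratic in \<open>n\<close>; without
  orthogonality it would grow like \<open>n ^ 4\<close>.\<close>

lemma fourth_moment_sum:
  fixes n :: nat
  assumes "\<And>i. i < n \<Longrightarrow> mom4 M (Z i)"
    and "\<And>i. i < n \<Longrightarrow> 0 \<le> c i" "\<And>i. i < n \<Longrightarrow> (\<integral>\<omega>. Z i \<omega> ^ 4 \<partial>M) \<le> (c i)\<^sup>2"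
    and "\<And>k. k < n \<Longrightarrow> (\<integral>\<omega>. (\<Sum>i<k. Z i \<omega>) ^ 3 * Z k \<omega> \<partial>M) = 0"
  shows "(\<integral>\<omega>. (\<Sum>i<n. Z i \<omega>) ^ 4 \<partial>M) \<le> (4 * (\<Sum>i<n. c i))\<^sup>2"
  using assms
proof (induction n)
  case (Suc n)
  have "(\<integral>\<omega>. ((\<Sum>i<n. Z i \<omega>) + Z n \<omega>) ^ 4 \<partial>M) \<le> (4 * (\<Sum>i<n. c i) + 4 * c n)\<^sup>2"
    by (rule fourth_moment_add) (use Suc in \<open>auto intro!: mom4_sum sum_nonneg\<close>)
  then show ?case by (simp add: algebra_simps)
qed simp

text \<open>The increment of the centred quadratic form \<open>x\<^sup>* B x - tr B\<close> when the coordinate \<open>x k\<close> is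
  revealed after \<open>x 0, \<dots>, x (k - 1)\<close>.\<close>

definition form_diff :: "(nat \<Rightarrow> nat \<Rightarrow> complex) \<Rightarrow> nat \<Rightarrow> (nat \<Rightarrow> complex) \<Rightarrow> real" where
  "form_diff B k x = Re (B k k) * ((cmod (x k))\<^sup>2 - 1) +
     2 * (Re (\<Sum>j<k. B k j * x j) * Re (x k) + Im (\<Sum>j<k. B k j * x j) * Im (x k))"

text \<open>Passing from \<open>n\<close> to \<open>Suc n\<close> adds a row and a column with
  conjugate sums, hence the factor 2 in \<open>form_diff\<close>, and a diagonal entry that is real
  because the matrix is Hermitian.\<close>

lemma sum_form_diff:
  assumes herm: "\<And>i j. i < n \<Longrightarrow> j < n \<Longrightarrow> B i j = cnj (B j i)"
  shows "(\<Sum>i<n. form_diff B i x) =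
    Re (\<Sum>i<n. \<Sum>j<n. cnj (x i) * B i j * x j) - (\<Sum>i<n. Re (B i i))"
  using assms
proof (induction n)
  case (Suc n)
  define v where "v = (\<Sum>j<n. B n j * x j)"
  have "(\<Sum>i<n. cnj (x i) * B i n * x n) = cnj (cnj (x n) * v)"
    unfolding v_def sum_distrib_left cnj_sum
    by (rule sum.cong[OF refl]) (use Suc.prems[of _ n] in simp)
  then have col: "Re (\<Sum>i<n. cnj (x i) * B i n * x n) = Re (x n) * Re v + Im (x n) * Im v"
    by simp
  have row: "(\<Sum>j<n. cnj (x n) * B n j * x j) = cnj (x n) * v"
    by (simp add: v_def sum_distrib_left mult.assoc)
  have "Im (B n n) = 0" using arg_cong[OF Suc.prems[of n n], of Im] by simp
  then have diag: "Re (cnj (x n) * B n n * x n) = Re (B n n) * (cmod (x n))\<^sup>2"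
    by (simp add: cmod_power2) (simp add: power2_eq_square algebra_simps)
  have eq: "(\<Sum>i<Suc n. \<Sum>j<Suc n. cnj (x i) * B i j * x j) =
      (\<Sum>i<n. \<Sum>j<n. cnj (x i) * B i j * x j) + (\<Sum>i<n. cnj (x i) * B i n * x n)
      + (cnj (x n) * v + cnj (x n) * B n n * x n)"
    by (simp add: sum.distrib row)
  have "Re (\<Sum>i<Suc n. \<Sum>j<Suc n. cnj (x i) * B i j * x j) =
      Re (\<Sum>i<n. \<Sum>j<n. cnj (x i) * B i j * x j) + 2 * (Re v * Re (x n) + Im v * Im (x n))
      + Re (B n n) * (cmod (x n))\<^sup>2"
    unfolding eq plus_complex.sel col diag by simp
  moreover have "(\<Sum>i<n. form_diff B i x) =
    Re (\<Sum>i<n. \<Sum>j<n. cnj (x i) * B i j * x j) - (\<Sum>i<n. Re (B i i))"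
    by (rule Suc.IH, rule Suc.prems) simp_all
  ultimately show ?case by (simp add: form_diff_def v_def algebra_simps)
qed simp

text \<open>The moment information on the Gaussian entries. The eighth moment enters because
  \<open>(cmod (X i \<omega>))\<^sup>2 - 1\<close> is raised to the fourth power.\<close>

locale white_vector = prob_space M for M :: "'a measure" +
  fixes X :: "nat \<Rightarrow> 'a \<Rightarrow> complex" and N :: nat and \<kappa> :: real
  assumes indep: "indep_vars (\<lambda>_. borel) X {..<N}"
    and mean_Re: "\<And>i. i < N \<Longrightarrow> (\<integral>\<omega>. Re (X i \<omega>) \<partial>M) = 0"
    and mean_Im: "\<And>i. i < N \<Longrightarrow> (\<integral>\<omega>. Im (X i \<omega>) \<partial>M) = 0"
    and second: "\<And>i. i < N \<Longrightarrow> (\<integral>\<omega>. (cmod (X i \<omega>))\<^sup>2 \<partial>M) = 1"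
    and int8: "\<And>i. i < N \<Longrightarrow> integrable M (\<lambda>\<omega>. cmod (X i \<omega>) ^ 8)"
    and eighth: "\<And>i. i < N \<Longrightarrow> (\<integral>\<omega>. cmod (X i \<omega>) ^ 8 \<partial>M) \<le> \<kappa>"
begin

lemma X_meas [measurable]: "i < N \<Longrightarrow> X i \<in> borel_measurable M"
  using indep by (auto simp: indep_vars_def)

lemma kappa_nonneg: "0 < N \<Longrightarrow> 0 \<le> \<kappa>"
  by (rule order_trans[OF _ eighth[of 0]]) simp_all

lemma pow_le_1_pow8:
  assumes "k \<le> 8" "0 \<le> (x::real)"
  shows "x ^ k \<le> 1 + x ^ 8"
proof (cases "x \<le> 1")
  case True
  then have "x ^ k \<le> 1" using assms by (simp add: power_le_one)
  then show ?thesis using assms by (simp add: add_increasing2)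
next
  case False
  then have "x ^ k \<le> x ^ 8" using assms by (intro power_increasing) auto
  then show ?thesis by simp
qed

lemma X_pow_integrable: "i < N \<Longrightarrow> k \<le> 8 \<Longrightarrow> integrable M (\<lambda>\<omega>. cmod (X i \<omega>) ^ k)"
  by (rule Bochner_Integration.integrable_bound[of M "\<lambda>\<omega>. 1 + cmod (X i \<omega>) ^ 8"])
     (auto simp: int8 pow_le_1_pow8)

lemma X_pow_le: "i < N \<Longrightarrow> k \<le> 8 \<Longrightarrow> (\<integral>\<omega>. cmod (X i \<omega>) ^ k \<partial>M) \<le> 1 + \<kappa>"
proof -
  assume i: "i < N" and k: "k \<le> 8"
  have "(\<integral>\<omega>. cmod (X i \<omega>) ^ k \<partial>M) \<le> (\<integral>\<omega>. 1 + cmod (X i \<omega>) ^ 8 \<partial>M)"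
    using i k by (intro integral_mono) (auto simp: X_pow_integrable pow_le_1_pow8 int8)
  also have "\<dots> \<le> 1 + \<kappa>" using i eighth int8 by (simp add: prob_space)
  finally show ?thesis .
qed

text \<open>Plays the part of a filtration: the coordinates before \<open>k\<close>, taken as one
  tuple, are independent of coordinate \<open>k\<close>, so conditional expectations are
  avoided.\<close>

lemma indep_past:
  assumes "k < N" "F \<in> borel_measurable (PiM {..<k} (\<lambda>_. borel))" "G \<in> borel_measurable borel"
  shows "indep_var borel (\<lambda>\<omega>. F (\<lambda>i\<in>{..<k}. X i \<omega>)) borel (\<lambda>\<omega>. G (X k \<omega>))"
proof -
  have "indep_var (PiM {..<k} (\<lambda>_. borel)) (\<lambda>\<omega>. \<lambda>i\<in>{..<k}. X i \<omega>) (PiM {k} (\<lambda>_. borel)) (\<lambda>\<omega>. \<lambda>i\<in>{k}. X i \<omega>)"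
    using assms(1) by (intro indep_var_restrict[OF indep]) auto
  from indep_var_compose[OF this assms(2), of "\<lambda>x. G (x k)" borel] show ?thesis
    using assms(3) by (simp add: comp_def)
qed

text \<open>The condition on \<open>restrict\<close> says that \<open>F\<close> looks only at
  coordinates below \<open>k\<close>; it lets the truncated tuple be replaced by the whole
  sequence.\<close>

lemma indep_past_integral:
  fixes F :: "(nat \<Rightarrow> complex) \<Rightarrow> real" and G :: "complex \<Rightarrow> real"
  assumes "k < N" "F \<in> borel_measurable (PiM {..<k} (\<lambda>_. borel))" "G \<in> borel_measurable borel"
    and "\<And>x. F (restrict x {..<k}) = F x"
    and "integrable M (\<lambda>\<omega>. F (\<lambda>i. X i \<omega>))" "integrable M (\<lambda>\<omega>. G (X k \<omega>))"
  shows "integrable M (\<lambda>\<omega>. F (\<lambda>i. X i \<omega>) * G (X k \<omega>))"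
    and "(\<integral>\<omega>. F (\<lambda>i. X i \<omega>) * G (X k \<omega>) \<partial>M) = (\<integral>\<omega>. F (\<lambda>i. X i \<omega>) \<partial>M) * (\<integral>\<omega>. G (X k \<omega>) \<partial>M)"
  using indep_var_integrable[OF indep_past[OF assms(1-3)]] indep_var_lebesgue_integral[OF indep_past[OF assms(1-3)]]
    assms(4-6) by simp_all

lemma mom4_const: "mom4 M (\<lambda>_. a :: real)"
  by (simp add: mom4_def)

lemma mom4_cube_integrable: "mom4 M S \<Longrightarrow> integrable M (\<lambda>\<omega>. S \<omega> ^ 3)"
  using mom4_cube_mult[OF _ mom4_const[of 1], of S] by simp

lemma mom4_integrable: "mom4 M S \<Longrightarrow> integrable M S"
  using mom4_cube_mult[OF mom4_const[of 1], of S] by simp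

lemma cmod_mom4: "i < N \<Longrightarrow> mom4 M (\<lambda>\<omega>. cmod (X i \<omega>))"
  using X_pow_integrable[of i 4] by (simp add: mom4_def)

lemma mom4_le:
  assumes "mom4 M S" "Z \<in> borel_measurable M" "\<And>\<omega>. \<bar>Z \<omega>\<bar> \<le> \<bar>S \<omega>\<bar>"
  shows "mom4 M Z" "(\<integral>\<omega>. Z \<omega> ^ 4 \<partial>M) \<le> (\<integral>\<omega>. S \<omega> ^ 4 \<partial>M)"
proof -
  have le: "Z \<omega> ^ 4 \<le> S \<omega> ^ 4" for \<omega>
    using power_mono[OF assms(3), of \<omega> 4] by (simp add: power_even_abs)
  have int: "integrable M (\<lambda>\<omega>. S \<omega> ^ 4)" using assms(1) by (simp add: mom4_def)
  have "integrable M (\<lambda>\<omega>. Z \<omega> ^ 4)"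
    by (rule Bochner_Integration.integrable_bound[OF int]) (use assms(2) le in \<open>auto\<close>)
  then show "mom4 M Z" using assms(2) by (simp add: mom4_def)
  show "(\<integral>\<omega>. Z \<omega> ^ 4 \<partial>M) \<le> (\<integral>\<omega>. S \<omega> ^ 4 \<partial>M)"
    by (rule integral_mono) (use \<open>integrable M (\<lambda>\<omega>. Z \<omega> ^ 4)\<close> int le in auto)
qed

lemma Re_Im_integrable:
  assumes "i < N"
  shows "integrable M (\<lambda>\<omega>. Re (X i \<omega>))" "integrable M (\<lambda>\<omega>. Im (X i \<omega>))"
  by (rule Bochner_Integration.integrable_bound[OF mom4_integrable[OF cmod_mom4[OF assms]]];
      use X_meas[OF assms] in \<open>auto simp: abs_Re_le_cmod abs_Im_le_cmod\<close>)+

text \<open>The summands are independent with mean zero, hence orthogonal to the cubes of the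
  preceding partial sums. Imaginary parts are covered by multiplying the coefficients by
  \<open>- \<i>\<close>.\<close>

lemma linear_form_moment:
  assumes "k \<le> N"
  shows "mom4 M (\<lambda>\<omega>. Re (\<Sum>j<k. a j * X j \<omega>))" (is "mom4 M ?S")
    and "(\<integral>\<omega>. Re (\<Sum>j<k. a j * X j \<omega>) ^ 4 \<partial>M) \<le> (4 * ((1 + \<kappa>) * (\<Sum>j<k. (cmod (a j))\<^sup>2)))\<^sup>2"
proof -
  define Z where "Z j \<omega> = Re (a j * X j \<omega>)" for j \<omega>
  \<comment> \<open>Since \<open>1 \<le> 1 + \<kappa>\<close>, the bound
    \<open>cmod (a j) ^ 4 * (1 + \<kappa>)\<close> can be weakened to the square of
    \<open>c j\<close>, the form in which bounds add up.\<close>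
  define c where "c j = (1 + \<kappa>) * (cmod (a j))\<^sup>2" for j
  have Z: "mom4 M (Z j)" "(\<integral>\<omega>. Z j \<omega> ^ 4 \<partial>M) \<le> (c j)\<^sup>2" "0 \<le> c j" if "j < k" for j
  proof -
    have j: "j < N" using that assms by simp
    have [measurable]: "Z j \<in> borel_measurable M" using X_meas[OF j] by (simp add: Z_def[abs_def])
    have le: "\<bar>Z j \<omega>\<bar> \<le> \<bar>cmod (a j) * cmod (X j \<omega>)\<bar>" for \<omega>
      using abs_Re_le_cmod[of "a j * X j \<omega>"] by (simp add: Z_def norm_mult)
    show "mom4 M (Z j)"
      by (rule mom4_le(1)[OF mom4_cmult[OF cmod_mom4[OF j]] _ le]) simp
    have \<kappa>: "0 \<le> \<kappa>" using kappa_nonneg j by simp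
    then show "0 \<le> c j" by (simp add: c_def)
    have "(\<integral>\<omega>. Z j \<omega> ^ 4 \<partial>M) \<le> (\<integral>\<omega>. (cmod (a j) * cmod (X j \<omega>)) ^ 4 \<partial>M)"
      by (rule mom4_le(2)[OF mom4_cmult[OF cmod_mom4[OF j]] _ le]) simp
    also have "\<dots> = cmod (a j) ^ 4 * (\<integral>\<omega>. cmod (X j \<omega>) ^ 4 \<partial>M)" by (simp add: power_mult_distrib)
    also have "\<dots> \<le> cmod (a j) ^ 4 * (1 + \<kappa>)" using X_pow_le[OF j, of 4] by (intro mult_left_mono) auto
    also have "\<dots> \<le> cmod (a j) ^ 4 * (1 + \<kappa>)\<^sup>2"
      using \<kappa> self_le_power[of "1 + \<kappa>" 2] by (intro mult_left_mono) auto
    also have "\<dots> = (c j)\<^sup>2" by (simp add: c_def power_mult_distrib mult.commute)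
    finally show "(\<integral>\<omega>. Z j \<omega> ^ 4 \<partial>M) \<le> (c j)\<^sup>2" .
  qed
  have S: "?S = (\<lambda>\<omega>. \<Sum>j<k. Z j \<omega>)" by (simp add: Z_def)
  show "mom4 M ?S" unfolding S by (rule mom4_sum) (simp add: Z)
  have orth: "(\<integral>\<omega>. (\<Sum>i<j. Z i \<omega>) ^ 3 * Z j \<omega> \<partial>M) = 0" if "j < k" for j
  proof -
    define F where "F x = (\<Sum>i<j. Re (a i * x i)) ^ 3" for x
    have j: "j < N" using that assms by simp
    have mZ: "mom4 M (\<lambda>\<omega>. \<Sum>i<j. Z i \<omega>)" by (rule mom4_sum) (use Z that in auto)
    have intG: "integrable M (\<lambda>\<omega>. Re (a j * X j \<omega>))"
      using mom4_integrable[OF Z(1)[OF that]] by (simp add: Z_def[abs_def])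
    have Fm: "F \<in> borel_measurable (PiM {..<j} (\<lambda>_. borel))"
      unfolding F_def[abs_def] by measurable
    have "(\<integral>\<omega>. F (\<lambda>i. X i \<omega>) * Re (a j * X j \<omega>) \<partial>M) = (\<integral>\<omega>. F (\<lambda>i. X i \<omega>) \<partial>M) * (\<integral>\<omega>. Re (a j * X j \<omega>) \<partial>M)"
      using mom4_cube_integrable[OF mZ] intG
      by (intro indep_past_integral(2)[OF j Fm]) (auto simp: F_def Z_def)
    moreover have "(\<integral>\<omega>. Re (a j * X j \<omega>) \<partial>M) = 0"
    proof -
      note Re_Im_integrable[OF j]
      then show ?thesis using mean_Re[OF j] mean_Im[OF j] by simp
    qed
    ultimately show ?thesis by (simp add: F_def Z_def)
  qed
  have "(\<integral>\<omega>. (\<Sum>j<k. Z j \<omega>) ^ 4 \<partial>M) \<le> (4 * (\<Sum>j<k. c j))\<^sup>2"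
    by (rule fourth_moment_sum) (use Z orth in auto)
  then show "(\<integral>\<omega>. Re (\<Sum>j<k. a j * X j \<omega>) ^ 4 \<partial>M) \<le> (4 * ((1 + \<kappa>) * (\<Sum>j<k. (cmod (a j))\<^sup>2)))\<^sup>2"
    unfolding S by (simp add: Z_def c_def sum_distrib_left)
qed

lemma past_form_measurable:
  fixes i k :: nat
  assumes "i \<le> k"
  shows "(\<lambda>x. \<Sum>j<i. a j * x j) \<in> borel_measurable (PiM {..<k} (\<lambda>_. borel :: complex measure))"
proof (rule borel_measurable_sum)
  fix j assume "j \<in> {..<i}"
  then have [measurable]: "(\<lambda>x. x j) \<in> borel_measurable (PiM {..<k} (\<lambda>_. borel :: complex measure))"
    using assms by (intro measurable_component_singleton) simp
  show "(\<lambda>x. a j * x j) \<in> borel_measurable (PiM {..<k} (\<lambda>_. borel :: complex measure))" by measurable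
qed

lemma form_diff_measurable:
  assumes "i < k"
  shows "form_diff B i \<in> borel_measurable (PiM {..<k} (\<lambda>_. borel))"
proof -
  have [measurable]: "(\<lambda>x. x i) \<in> borel_measurable (PiM {..<k} (\<lambda>_. borel :: complex measure))"
    using assms by (intro measurable_component_singleton) auto
  have [measurable]: "(\<lambda>x. \<Sum>j<i. B i j * x j) \<in> borel_measurable (PiM {..<k} (\<lambda>_. borel :: complex measure))"
    using assms by (intro past_form_measurable) auto
  show ?thesis unfolding form_diff_def[abs_def] by measurable
qed

text \<open>\<open>G\<close> will be \<open>Re\<close> or \<open>Im\<close>. By independence the
  fourth moment of the product factorises: \<open>16 * (1 + \<kappa>)\<^sup>2 * r\<^sup>2\<close>
  comes from the linear form, a further \<open>1 + \<kappa>\<close> from coordinate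
  \<open>k\<close>.\<close>

lemma past_part_moment:
  assumes k: "k < N" and r: "(\<Sum>j<k. (cmod (a j))\<^sup>2) \<le> r"
    and proj: "\<And>z. \<bar>G z\<bar> \<le> cmod z" "G \<in> borel_measurable borel"
    and v: "\<And>\<omega>. V \<omega> = Re (\<Sum>j<k. a j * X j \<omega>)"
  shows "mom4 M (\<lambda>\<omega>. V \<omega> * G (X k \<omega>))"
    and "(\<integral>\<omega>. (V \<omega> * G (X k \<omega>)) ^ 4 \<partial>M) \<le> 16 * (1 + \<kappa>) ^ 3 * r\<^sup>2"
proof -
  have \<kappa>: "0 \<le> \<kappa>" using kappa_nonneg k by simp
  have V_eq: "V = (\<lambda>\<omega>. Re (\<Sum>j<k. a j * X j \<omega>))" using v by blast
  have V: "mom4 M V" unfolding V_eq by (rule linear_form_moment(1)) (use k in simp)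
  have Gm: "mom4 M (\<lambda>\<omega>. G (X k \<omega>))" "(\<integral>\<omega>. G (X k \<omega>) ^ 4 \<partial>M) \<le> 1 + \<kappa>"
  proof -
    have meas: "(\<lambda>\<omega>. G (X k \<omega>)) \<in> borel_measurable M"
      using measurable_compose[OF X_meas[OF k] proj(2)] .
    have le: "\<bar>G (X k \<omega>)\<bar> \<le> \<bar>cmod (X k \<omega>)\<bar>" for \<omega> using proj(1) by simp
    show "mom4 M (\<lambda>\<omega>. G (X k \<omega>))" by (rule mom4_le(1)[OF cmod_mom4[OF k] meas le])
    show "(\<integral>\<omega>. G (X k \<omega>) ^ 4 \<partial>M) \<le> 1 + \<kappa>"
      by (rule order_trans[OF mom4_le(2)[OF cmod_mom4[OF k] meas le] X_pow_le[OF k]]) simp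
  qed
  define F where "F x = Re (\<Sum>j<k. a j * x j) ^ 4" for x
  have [measurable]: "(\<lambda>x. \<Sum>j<k. a j * x j) \<in> borel_measurable (PiM {..<k} (\<lambda>_. borel :: complex measure))"
    by (rule past_form_measurable) simp
  have F: "F \<in> borel_measurable (PiM {..<k} (\<lambda>_. borel))" unfolding F_def[abs_def] by measurable
  have G4: "(\<lambda>z. G z ^ 4) \<in> borel_measurable borel" using proj(2) by measurable
  have FX: "F (\<lambda>i. X i \<omega>) = V \<omega> ^ 4" for \<omega> by (simp add: F_def v)
  note prod = indep_past_integral[OF k F G4, unfolded FX]
  have res: "F (restrict x {..<k}) = F x" for x by (simp add: F_def)
  have int: "integrable M (\<lambda>\<omega>. V \<omega> ^ 4)" "integrable M (\<lambda>\<omega>. G (X k \<omega>) ^ 4)"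
    using V Gm by (auto simp: mom4_def)
  show "mom4 M (\<lambda>\<omega>. V \<omega> * G (X k \<omega>))"
    using prod(1)[OF res int] V Gm by (auto simp: mom4_def power_mult_distrib)
  have "(\<integral>\<omega>. (V \<omega> * G (X k \<omega>)) ^ 4 \<partial>M) = (\<integral>\<omega>. V \<omega> ^ 4 \<partial>M) * (\<integral>\<omega>. G (X k \<omega>) ^ 4 \<partial>M)"
    using prod(2)[OF res int] by (simp add: power_mult_distrib)
  also have "\<dots> \<le> (4 * ((1 + \<kappa>) * r))\<^sup>2 * (1 + \<kappa>)"
  proof (rule mult_mono[OF _ Gm(2)])
    have "(\<integral>\<omega>. V \<omega> ^ 4 \<partial>M) \<le> (4 * ((1 + \<kappa>) * (\<Sum>j<k. (cmod (a j))\<^sup>2)))\<^sup>2"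
      unfolding V_eq by (rule linear_form_moment(2)) (use k in simp)
    also have "\<dots> \<le> (4 * ((1 + \<kappa>) * r))\<^sup>2"
      using r \<kappa> by (intro power_mono mult_left_mono) (simp_all add: sum_nonneg)
    finally show "(\<integral>\<omega>. V \<omega> ^ 4 \<partial>M) \<le> (4 * ((1 + \<kappa>) * r))\<^sup>2" .
  qed simp_all
  also have "\<dots> = 16 * (1 + \<kappa>) ^ 3 * r\<^sup>2" by (simp add: power_mult_distrib power3_eq_cube power2_eq_square)
  finally show "(\<integral>\<omega>. (V \<omega> * G (X k \<omega>)) ^ 4 \<partial>M) \<le> 16 * (1 + \<kappa>) ^ 3 * r\<^sup>2" .
qed

lemma square_minus_one_moment:
  assumes k: "k < N"
  shows "mom4 M (\<lambda>\<omega>. (cmod (X k \<omega>))\<^sup>2 - 1)"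
    and "(\<integral>\<omega>. ((cmod (X k \<omega>))\<^sup>2 - 1) ^ 4 \<partial>M) \<le> 8 * (1 + \<kappa>)"
    and "(\<integral>\<omega>. (cmod (X k \<omega>))\<^sup>2 - 1 \<partial>M) = 0"
proof -
  have X2: "mom4 M (\<lambda>\<omega>. (cmod (X k \<omega>))\<^sup>2)"
    using int8[OF k] X_meas[OF k] by (simp add: mom4_def power_mult[symmetric])
  show "mom4 M (\<lambda>\<omega>. (cmod (X k \<omega>))\<^sup>2 - 1)"
    using mom4_add[OF X2 mom4_const[of "-1"]] by simp
  show "(\<integral>\<omega>. ((cmod (X k \<omega>))\<^sup>2 - 1) ^ 4 \<partial>M) \<le> 8 * (1 + \<kappa>)"
    using expectation_pow4_add_le[OF X2 mom4_const[of "-1"]] eighth[OF k]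
    by (simp add: power_mult[symmetric] prob_space)
  show "(\<integral>\<omega>. (cmod (X k \<omega>))\<^sup>2 - 1 \<partial>M) = 0"
    using second[OF k] mom4_integrable[OF X2] by (simp add: prob_space)
qed

text \<open>The increment splits into a diagonal part, controlled by the eighth moment, and two
  products of a linear form in the past with the real or imaginary part of the new
  coordinate.\<close>

lemma form_diff_moment:
  assumes k: "k < N" and r: "(\<Sum>j<N. (cmod (B k j))\<^sup>2) \<le> r"
  shows "mom4 M (\<lambda>\<omega>. form_diff B k (\<lambda>i. X i \<omega>))"
    and "(\<integral>\<omega>. form_diff B k (\<lambda>i. X i \<omega>) ^ 4 \<partial>M) \<le> (182 * (1 + \<kappa>)\<^sup>2 * r)\<^sup>2"
proof -
  \<comment> \<open>As \<open>1 \<le> L\<close>, all powers of \<open>L\<close> can be raised to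
    \<open>L ^ 4\<close>, so that the total is a single square.\<close>
  define L where "L = 1 + \<kappa>"
  have L: "1 \<le> L" using kappa_nonneg k by (simp add: L_def)
  define U where "U \<omega> = (cmod (X k \<omega>))\<^sup>2 - 1" for \<omega>
  define P where "P \<omega> = Re (\<Sum>j<k. B k j * X j \<omega>) * Re (X k \<omega>)" for \<omega>
  define Q where "Q \<omega> = Im (\<Sum>j<k. B k j * X j \<omega>) * Im (X k \<omega>)" for \<omega>
  have rk: "(\<Sum>j<k. (cmod (B k j))\<^sup>2) \<le> r"
    by (rule order_trans[OF sum_mono2 r]) (use k in auto)
  have P: "mom4 M P" "(\<integral>\<omega>. P \<omega> ^ 4 \<partial>M) \<le> 16 * L ^ 3 * r\<^sup>2"
    unfolding P_def[abs_def] L_def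
    by (rule past_part_moment[where G = Re, OF k rk abs_Re_le_cmod borel_measurable_Re refl])+
  have rk': "(\<Sum>j<k. (cmod (- \<i> * B k j))\<^sup>2) \<le> r" using rk by (simp add: norm_mult)
  have Im_eq: "Im (\<Sum>j<k. B k j * X j \<omega>) = Re (\<Sum>j<k. (- \<i> * B k j) * X j \<omega>)" for \<omega>
    unfolding Im_sum Re_sum by (rule sum.cong) simp_all
  have Q: "mom4 M Q" "(\<integral>\<omega>. Q \<omega> ^ 4 \<partial>M) \<le> 16 * L ^ 3 * r\<^sup>2"
    unfolding Q_def[abs_def] L_def
    by (rule past_part_moment[where G = Im, OF k rk' abs_Im_le_cmod borel_measurable_Im Im_eq])+
  have U: "mom4 M U" "(\<integral>\<omega>. U \<omega> ^ 4 \<partial>M) \<le> 8 * L"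
    using square_minus_one_moment[OF k] by (simp_all add: U_def[abs_def] L_def)
  have bU: "mom4 M (\<lambda>\<omega>. Re (B k k) * U \<omega>)" by (rule mom4_cmult[OF U(1)])
  have PQ: "mom4 M (\<lambda>\<omega>. P \<omega> + Q \<omega>)" by (rule mom4_add[OF P(1) Q(1)])
  have PQ2: "mom4 M (\<lambda>\<omega>. 2 * (P \<omega> + Q \<omega>))" by (rule mom4_cmult[OF PQ])
  have Z: "(\<lambda>\<omega>. form_diff B k (\<lambda>i. X i \<omega>)) = (\<lambda>\<omega>. Re (B k k) * U \<omega> + 2 * (P \<omega> + Q \<omega>))"
    by (simp add: form_diff_def U_def P_def Q_def)
  show "mom4 M (\<lambda>\<omega>. form_diff B k (\<lambda>i. X i \<omega>))" unfolding Z by (rule mom4_add[OF bU PQ2])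
  have "(Re (B k k))\<^sup>2 \<le> (cmod (B k k))\<^sup>2" by (simp add: cmod_power2)
  also have "\<dots> \<le> (\<Sum>j<N. (cmod (B k j))\<^sup>2)"
    by (rule member_le_sum[of k _ "\<lambda>j. (cmod (B k j))\<^sup>2"]) (use k in auto)
  finally have b2: "(Re (B k k))\<^sup>2 \<le> r" using r by simp
  then have "((Re (B k k))\<^sup>2)\<^sup>2 \<le> r\<^sup>2" by (intro power_mono) simp_all
  then have b4: "Re (B k k) ^ 4 \<le> r\<^sup>2" by simp
  have LL: "L \<le> L ^ 4" "L ^ 3 \<le> L ^ 4" using self_le_power[OF L, of 4] power_increasing[OF _ L, of 3 4] by simp_all
  have "(\<integral>\<omega>. (Re (B k k) * U \<omega> + 2 * (P \<omega> + Q \<omega>)) ^ 4 \<partial>M) \<le>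
      8 * ((\<integral>\<omega>. (Re (B k k) * U \<omega>) ^ 4 \<partial>M) + (\<integral>\<omega>. (2 * (P \<omega> + Q \<omega>)) ^ 4 \<partial>M))"
    by (rule expectation_pow4_add_le[OF bU PQ2])
  also have "\<dots> = 8 * (Re (B k k) ^ 4 * (\<integral>\<omega>. U \<omega> ^ 4 \<partial>M) + 16 * (\<integral>\<omega>. (P \<omega> + Q \<omega>) ^ 4 \<partial>M))"
    by (simp only: power_mult_distrib integral_mult_right_zero) simp
  finally have 1: "(\<integral>\<omega>. (Re (B k k) * U \<omega> + 2 * (P \<omega> + Q \<omega>)) ^ 4 \<partial>M) \<le>
      8 * (Re (B k k) ^ 4 * (\<integral>\<omega>. U \<omega> ^ 4 \<partial>M) + 16 * (\<integral>\<omega>. (P \<omega> + Q \<omega>) ^ 4 \<partial>M))" .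
  have 2: "Re (B k k) ^ 4 * (\<integral>\<omega>. U \<omega> ^ 4 \<partial>M) \<le> r\<^sup>2 * (8 * L)"
    by (rule mult_mono[OF b4 U(2)]) simp_all
  have 3: "(\<integral>\<omega>. (P \<omega> + Q \<omega>) ^ 4 \<partial>M) \<le> 8 * (16 * L ^ 3 * r\<^sup>2 + 16 * L ^ 3 * r\<^sup>2)"
    by (rule order_trans[OF expectation_pow4_add_le[OF P(1) Q(1)] mult_left_mono[OF add_mono[OF P(2) Q(2)]]]) simp
  have 4: "r\<^sup>2 * L \<le> r\<^sup>2 * L ^ 4" "r\<^sup>2 * L ^ 3 \<le> r\<^sup>2 * L ^ 4"
    by (rule mult_left_mono; use LL in simp)+
  have "(\<integral>\<omega>. (Re (B k k) * U \<omega> + 2 * (P \<omega> + Q \<omega>)) ^ 4 \<partial>M) \<le> 33124 * (r\<^sup>2 * L ^ 4)"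
  proof -
    have arith: "T \<le> 33124 * x" if "T \<le> 8 * (A + 16 * E)" "A \<le> 8 * u" "E \<le> 256 * v" "u \<le> x" "v \<le> x" "0 \<le> x"
      for T A E u v x :: real using that by simp
    have 2: "Re (B k k) ^ 4 * (\<integral>\<omega>. U \<omega> ^ 4 \<partial>M) \<le> 8 * (r\<^sup>2 * L)"
      using 2 by (simp only: mult.left_commute)
    have "8 * (16 * L ^ 3 * r\<^sup>2 + 16 * L ^ 3 * r\<^sup>2) = 256 * (r\<^sup>2 * L ^ 3)" by (simp add: mult.commute)
    then have 3: "(\<integral>\<omega>. (P \<omega> + Q \<omega>) ^ 4 \<partial>M) \<le> 256 * (r\<^sup>2 * L ^ 3)"
      using 3 by (simp only:)
    \<comment> \<open>\<open>8 * 8 + 8 * 16 * 256 = 32832\<close>, rounded up to \<open>33124 = 182\<^sup>2\<close>.\<close>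
    show ?thesis by (rule arith[OF 1 2 3 4]) simp
  qed
  also have "\<dots> = (182 * L\<^sup>2 * r)\<^sup>2" by (simp add: power_mult_distrib)
  finally show "(\<integral>\<omega>. form_diff B k (\<lambda>i. X i \<omega>) ^ 4 \<partial>M) \<le> (182 * (1 + \<kappa>)\<^sup>2 * r)\<^sup>2"
    unfolding Z[THEN fun_cong] L_def .
qed

text \<open>After expansion each term is a function of the past times one of
  \<open>(cmod (X k \<omega>))\<^sup>2 - 1\<close>, \<open>Re (X k \<omega>)\<close> and
  \<open>Im (X k \<omega>)\<close>, which all have mean zero.\<close>

lemma form_diff_orth:
  assumes k: "k < N" and r: "\<And>i. i < N \<Longrightarrow> (\<Sum>j<N. (cmod (B i j))\<^sup>2) \<le> r"
  shows "(\<integral>\<omega>. (\<Sum>i<k. form_diff B i (\<lambda>i. X i \<omega>)) ^ 3 * form_diff B k (\<lambda>i. X i \<omega>) \<partial>M) = 0"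
proof -
  define F where "F x = (\<Sum>i<k. form_diff B i x) ^ 3" for x
  define V where "V x = (\<Sum>j<k. B k j * x j)" for x :: "nat \<Rightarrow> complex"
  have "(\<lambda>x. \<Sum>i<k. form_diff B i x) \<in> borel_measurable (PiM {..<k} (\<lambda>_. borel))"
    by (rule borel_measurable_sum) (simp add: form_diff_measurable)
  then have F[measurable]: "F \<in> borel_measurable (PiM {..<k} (\<lambda>_. borel))"
    unfolding F_def[abs_def] by (rule borel_measurable_power)
  have V[measurable]: "V \<in> borel_measurable (PiM {..<k} (\<lambda>_. borel))"
    unfolding V_def[abs_def] by (rule past_form_measurable) simp
  have res: "form_diff B i (restrict x {..<k}) = form_diff B i x" if "i < k" for i x
  proof -
    have "(\<Sum>j<i. B i j * restrict x {..<k} j) = (\<Sum>j<i. B i j * x j)"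
      using that by (intro sum.cong) auto
    then show ?thesis using that unfolding form_diff_def by simp
  qed
  have resF: "F (restrict x {..<k}) = F x" for x
    unfolding F_def by (rule arg_cong[where f = "\<lambda>s. s ^ 3"], rule sum.cong) (simp_all only: res lessThan_iff)
  have resV: "V (restrict x {..<k}) = V x" for x
    unfolding V_def by (rule sum.cong) simp_all
  have S: "mom4 M (\<lambda>\<omega>. \<Sum>i<k. form_diff B i (\<lambda>i. X i \<omega>))"
    by (rule mom4_sum, rule form_diff_moment(1)[where B = B, OF _ r]) (use k in auto)
  have ReV: "mom4 M (\<lambda>\<omega>. Re (V (\<lambda>i. X i \<omega>)))"
    unfolding V_def by (rule linear_form_moment(1)) (use k in simp)
  have "mom4 M (\<lambda>\<omega>. Re (\<Sum>j<k. (- \<i> * B k j) * X j \<omega>))"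
    by (rule linear_form_moment(1)) (use k in simp)
  moreover have "Re (\<Sum>j<k. (- \<i> * B k j) * X j \<omega>) = Im (V (\<lambda>i. X i \<omega>))" for \<omega>
    unfolding V_def Im_sum Re_sum by (rule sum.cong) simp_all
  ultimately have ImV: "mom4 M (\<lambda>\<omega>. Im (V (\<lambda>i. X i \<omega>)))" by (simp only:)
  have ReX: "integrable M (\<lambda>\<omega>. Re (X k \<omega>))" and ImX: "integrable M (\<lambda>\<omega>. Im (X k \<omega>))"
    by (rule Re_Im_integrable[OF k])+
  have intF: "integrable M (\<lambda>\<omega>. F (\<lambda>i. X i \<omega>))"
    using mom4_cube_integrable[OF S] by (simp add: F_def)
  have intFR: "integrable M (\<lambda>\<omega>. F (\<lambda>i. X i \<omega>) * Re (V (\<lambda>i. X i \<omega>)))"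
    and intFI: "integrable M (\<lambda>\<omega>. F (\<lambda>i. X i \<omega>) * Im (V (\<lambda>i. X i \<omega>)))"
    using mom4_cube_mult[OF S ReV] mom4_cube_mult[OF S ImV] by (simp_all add: F_def)
  have FRm: "(\<lambda>x. F x * Re (V x)) \<in> borel_measurable (PiM {..<k} (\<lambda>_. borel))"
    and FIm: "(\<lambda>x. F x * Im (V x)) \<in> borel_measurable (PiM {..<k} (\<lambda>_. borel))"
    by measurable
  note U = square_minus_one_moment[OF k]
  have resR: "F (restrict x {..<k}) * Re (V (restrict x {..<k})) = F x * Re (V x)"
    and resI: "F (restrict x {..<k}) * Im (V (restrict x {..<k})) = F x * Im (V x)" for x
    by (simp_all only: resF resV)
  have intU: "integrable M (\<lambda>\<omega>. (cmod (X k \<omega>))\<^sup>2 - 1)" by (rule mom4_integrable[OF U(1)])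
  have Gm: "(\<lambda>z::complex. (cmod z)\<^sup>2 - 1) \<in> borel_measurable borel" by measurable
  note ia = indep_past_integral[where F = F and k = k and G = "\<lambda>z. (cmod z)\<^sup>2 - 1", OF k F Gm resF intF intU]
  note ib = indep_past_integral[where F = "\<lambda>x. F x * Re (V x)" and k = k and G = Re, OF k FRm borel_measurable_Re resR intFR ReX]
  note ic = indep_past_integral[where F = "\<lambda>x. F x * Im (V x)" and k = k and G = Im, OF k FIm borel_measurable_Im resI intFI ImX]
  have zero: "(\<integral>\<omega>. F (\<lambda>i. X i \<omega>) * ((cmod (X k \<omega>))\<^sup>2 - 1) \<partial>M) = 0"
    "(\<integral>\<omega>. F (\<lambda>i. X i \<omega>) * Re (V (\<lambda>i. X i \<omega>)) * Re (X k \<omega>) \<partial>M) = 0"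
    "(\<integral>\<omega>. F (\<lambda>i. X i \<omega>) * Im (V (\<lambda>i. X i \<omega>)) * Im (X k \<omega>) \<partial>M) = 0"
    unfolding ia(2) ib(2) ic(2) U(3) mean_Re[OF k] mean_Im[OF k] by simp_all
  have ring: "f * (b * u + 2 * (x * y + z * v)) = b * (f * u) + (2 * (f * x * y) + 2 * (f * z * v))"
    for f b u x y z v :: real by (simp add: algebra_simps)
  have *: "(\<Sum>i<k. form_diff B i (\<lambda>i. X i \<omega>)) ^ 3 * form_diff B k (\<lambda>i. X i \<omega>) =
      Re (B k k) * (F (\<lambda>i. X i \<omega>) * ((cmod (X k \<omega>))\<^sup>2 - 1))
      + (2 * (F (\<lambda>i. X i \<omega>) * Re (V (\<lambda>i. X i \<omega>)) * Re (X k \<omega>))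
      + 2 * (F (\<lambda>i. X i \<omega>) * Im (V (\<lambda>i. X i \<omega>)) * Im (X k \<omega>)))" for \<omega>
    unfolding F_def form_diff_def[of B k] V_def by (rule ring)
  have i1: "integrable M (\<lambda>\<omega>. Re (B k k) * (F (\<lambda>i. X i \<omega>) * ((cmod (X k \<omega>))\<^sup>2 - 1)))"
    by (rule integrable_mult_right) (rule ia(1))
  have i2: "integrable M (\<lambda>\<omega>. 2 * (F (\<lambda>i. X i \<omega>) * Re (V (\<lambda>i. X i \<omega>)) * Re (X k \<omega>)))"
    by (rule integrable_mult_right) (rule ib(1))
  have i3: "integrable M (\<lambda>\<omega>. 2 * (F (\<lambda>i. X i \<omega>) * Im (V (\<lambda>i. X i \<omega>)) * Im (X k \<omega>)))"
    by (rule integrable_mult_right) (rule ic(1))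
  have "(\<integral>\<omega>. (\<Sum>i<k. form_diff B i (\<lambda>i. X i \<omega>)) ^ 3 * form_diff B k (\<lambda>i. X i \<omega>) \<partial>M) =
    (\<integral>\<omega>. Re (B k k) * (F (\<lambda>i. X i \<omega>) * ((cmod (X k \<omega>))\<^sup>2 - 1))
      + (2 * (F (\<lambda>i. X i \<omega>) * Re (V (\<lambda>i. X i \<omega>)) * Re (X k \<omega>))
      + 2 * (F (\<lambda>i. X i \<omega>) * Im (V (\<lambda>i. X i \<omega>)) * Im (X k \<omega>))) \<partial>M)"
    by (rule Bochner_Integration.integral_cong[OF refl *])
  also have "\<dots> = 0"
    unfolding Bochner_Integration.integral_add[OF i1 Bochner_Integration.integrable_add[OF i2 i3]]
      Bochner_Integration.integral_add[OF i2 i3] integral_mult_right_zero zero by simp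
  finally show ?thesis .
qed

text \<open>\<open>r\<close> bounds the squared row norms, so the squared Frobenius norm is at most
  \<open>N * r\<close>, and the fourth moment has the order of its square. The constant is
  \<open>728 = 4 * 182\<close>.\<close>

theorem quadratic_form_moment:
  assumes herm: "\<And>i j. i < N \<Longrightarrow> j < N \<Longrightarrow> B i j = cnj (B j i)"
    and r: "\<And>i. i < N \<Longrightarrow> (\<Sum>j<N. (cmod (B i j))\<^sup>2) \<le> r"
  shows "integrable M (\<lambda>\<omega>. (Re (\<Sum>i<N. \<Sum>j<N. cnj (X i \<omega>) * B i j * X j \<omega>) - (\<Sum>i<N. Re (B i i))) ^ 4)"
    and "(\<integral>\<omega>. (Re (\<Sum>i<N. \<Sum>j<N. cnj (X i \<omega>) * B i j * X j \<omega>) - (\<Sum>i<N. Re (B i i))) ^ 4 \<partial>M)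
      \<le> (728 * (1 + \<kappa>)\<^sup>2 * N * r)\<^sup>2"
proof -
  have eq: "Re (\<Sum>i<N. \<Sum>j<N. cnj (X i \<omega>) * B i j * X j \<omega>) - (\<Sum>i<N. Re (B i i)) =
      (\<Sum>i<N. form_diff B i (\<lambda>i. X i \<omega>))" for \<omega>
    by (rule sum_form_diff[where x = "\<lambda>i. X i \<omega>" and n = N and B = B, symmetric]) (rule herm)
  have "mom4 M (\<lambda>\<omega>. \<Sum>i<N. form_diff B i (\<lambda>i. X i \<omega>))"
    by (rule mom4_sum, rule form_diff_moment(1)[where B = B, OF _ r]) auto
  then show "integrable M (\<lambda>\<omega>. (Re (\<Sum>i<N. \<Sum>j<N. cnj (X i \<omega>) * B i j * X j \<omega>) - (\<Sum>i<N. Re (B i i))) ^ 4)"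
    unfolding eq by (simp add: mom4_def)
  have r0: "0 \<le> r" if "i < N" for i
    by (rule order_trans[OF sum_nonneg r[OF that]]) simp
  have "(\<integral>\<omega>. (\<Sum>i<N. form_diff B i (\<lambda>i. X i \<omega>)) ^ 4 \<partial>M) \<le> (4 * (\<Sum>i<N. 182 * (1 + \<kappa>)\<^sup>2 * r))\<^sup>2"
  proof (rule fourth_moment_sum)
    fix i assume i: "i < N"
    show "mom4 M (\<lambda>\<omega>. form_diff B i (\<lambda>i. X i \<omega>))"
      "(\<integral>\<omega>. form_diff B i (\<lambda>i. X i \<omega>) ^ 4 \<partial>M) \<le> (182 * (1 + \<kappa>)\<^sup>2 * r)\<^sup>2"
      by (rule form_diff_moment[where B = B, OF i r[OF i]])+
    show "0 \<le> 182 * (1 + \<kappa>)\<^sup>2 * r" using r0[OF i] by simp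
    show "(\<integral>\<omega>. (\<Sum>j<i. form_diff B j (\<lambda>i. X i \<omega>)) ^ 3 * form_diff B i (\<lambda>i. X i \<omega>) \<partial>M) = 0"
      by (rule form_diff_orth[OF i r])
  qed
  then show "(\<integral>\<omega>. (Re (\<Sum>i<N. \<Sum>j<N. cnj (X i \<omega>) * B i j * X j \<omega>) - (\<Sum>i<N. Re (B i i))) ^ 4 \<partial>M)
      \<le> (728 * (1 + \<kappa>)\<^sup>2 * N * r)\<^sup>2"
    unfolding eq by (simp add: mult_ac)
qed

end

section \<open>Concentration around the trace\<close>

lemma borel_measurable_cnj:
  "f \<in> borel_measurable L \<Longrightarrow> (\<lambda>y. cnj (f y)) \<in> borel_measurable L"
  by (rule borel_measurable_continuous_on[OF continuous_on_cnj[OF continuous_on_id]])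

lemma det_measurable:
  fixes A :: "'y \<Rightarrow> nat \<Rightarrow> nat \<Rightarrow> complex"
  assumes "\<And>i j. i < n \<Longrightarrow> j < n \<Longrightarrow> (\<lambda>y. A y i j) \<in> borel_measurable P"
  shows "(\<lambda>y. Determinant.det (mat n n (\<lambda>(i, j). A y i j))) \<in> borel_measurable P"
proof -
  have "(\<lambda>y. \<Sum>p\<in>{p. p permutes {0..<n}}. signof p * (\<Prod>i=0..<n. A y i (p i))) \<in> borel_measurable P"
    by (intro borel_measurable_sum borel_measurable_times borel_measurable_const borel_measurable_prod assms)
       (auto dest: permutes_in_image)
  moreover have "Determinant.det (mat n n (\<lambda>(i, j). A y i j)) =
      (\<Sum>p\<in>{p. p permutes {0..<n}}. signof p * (\<Prod>i=0..<n. A y i (p i)))" for y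
    unfolding det_def'[OF mat_carrier]
    by (intro sum.cong prod.cong arg_cong2[where f = "(*)"] refl) (auto dest: permutes_in_image)
  ultimately show ?thesis by simp
qed

lemma ridge_inv_measurable:
  assumes "w > 0" "finite S" "\<And>n. n \<in> S \<Longrightarrow> 0 \<le> c n"
    and h: "\<And>n i. n \<in> S \<Longrightarrow> i < N \<Longrightarrow> (\<lambda>y. h y n i) \<in> borel_measurable P"
    and "i < N" "l < N"
  shows "(\<lambda>y. ridge_inv N w c (h y) S i l) \<in> borel_measurable P"
proof -
  interpret ridge N w c h' S for h' by unfold_locales (use assms in auto)
  have entry: "(\<lambda>y. ridge_entry w c (h y) S i l) \<in> borel_measurable P" if "i < N" "l < N" for i l
    unfolding ridge_entry_def
    using that by (intro borel_measurable_add borel_measurable_sum borel_measurable_times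
        borel_measurable_const borel_measurable_cnj h)
  have det: "(\<lambda>y. Determinant.det (ridge_mat N w c (h y) S)) \<in> borel_measurable P"
    unfolding ridge_mat_def by (rule det_measurable[OF entry])
  \<comment> \<open>Deleting row \<open>l\<close> and column \<open>i\<close> is written as an index
    shift, so that the minor is again a \<open>mat\<close> with measurable entries; the adjugate
    swaps the two indices.\<close>
  have "mat_delete (ridge_mat N w c (h y) S) l i =
      mat (N - 1) (N - 1) (\<lambda>(a, b). ridge_entry w c (h y) S (if a < l then a else Suc a) (if b < i then b else Suc b))" for y
    by (rule eq_matI) (auto simp: mat_delete_def ridge_mat_def)
  then have adj: "adj_mat (ridge_mat N w c (h y) S) $$ (i, l) = (-1) ^ (l + i) * Determinant.det
      (mat (N - 1) (N - 1) (\<lambda>(a, b). ridge_entry w c (h y) S (if a < l then a else Suc a) (if b < i then b else Suc b)))" for y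
    using assms(5,6) by (simp add: adj_mat_def cofactor_def ridge_mat_def)
  have "(\<lambda>y. adj_mat (ridge_mat N w c (h y) S) $$ (i, l)) \<in> borel_measurable P"
    unfolding adj by (intro borel_measurable_times borel_measurable_const det_measurable entry) auto
  then have "(\<lambda>y. adj_mat (ridge_mat N w c (h y) S) $$ (i, l) / Determinant.det (ridge_mat N w c (h y) S)) \<in> borel_measurable P"
    using det by (rule borel_measurable_divide)
  then show ?thesis using ridge_inv_adj[OF subset_refl assms(5,6)] by simp
qed

text \<open>This makes the inverse a function of the columns in \<open>S\<close> alone, hence
  independent of any column outside \<open>S\<close>.\<close>

lemma ridge_inv_cong:
  assumes "\<And>n i. n \<in> S \<Longrightarrow> i < N \<Longrightarrow> h n i = h' n i"
  shows "ridge_inv N w c h S = ridge_inv N w c h' S"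
proof -
  have "ridge_mat N w c h S = ridge_mat N w c h' S"
    using assms by (intro eq_matI) (auto simp: ridge_mat_def ridge_entry_def intro!: sum.cong)
  then show ?thesis by (intro ext) (simp add: ridge_inv_def)
qed

text \<open>Fubini in place of conditioning: a bound valid for each fixed value of \<open>Y\<close>
  passes to the joint expectation. With nonnegative integrals, integrability need not be known
  beforehand.\<close>

lemma (in prob_space) nn_integral_indep_le:
  assumes indep: "indep_var P Y Q X"
    and meas: "g \<in> borel_measurable (P \<Otimes>\<^sub>M Q)"
    and bound: "\<And>y. (\<integral>\<^sup>+\<omega>. g (y, X \<omega>) \<partial>M) \<le> C"
  shows "(\<integral>\<^sup>+\<omega>. g (Y \<omega>, X \<omega>) \<partial>M) \<le> C"
proof -
  have Y[measurable]: "Y \<in> measurable M P" and X[measurable]: "X \<in> measurable M Q"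
    and eq: "distr M P Y \<Otimes>\<^sub>M distr M Q X = distr M (P \<Otimes>\<^sub>M Q) (\<lambda>x. (Y x, X x))"
    using indep unfolding indep_var_distribution_eq by auto
  interpret X: prob_space "distr M Q X" by (rule prob_space_distr[OF X])
  interpret Y: prob_space "distr M P Y" by (rule prob_space_distr[OF Y])
  note meas[measurable]
  have "(\<integral>\<^sup>+\<omega>. g (Y \<omega>, X \<omega>) \<partial>M) = integral\<^sup>N (distr M P Y \<Otimes>\<^sub>M distr M Q X) g"
    unfolding eq by (subst nn_integral_distr) auto
  also have "\<dots> = (\<integral>\<^sup>+y. \<integral>\<^sup>+x. g (y, x) \<partial>distr M Q X \<partial>distr M P Y)"
    by (rule X.nn_integral_fst[symmetric]) simp
  also have "\<dots> \<le> (\<integral>\<^sup>+y. C \<partial>distr M P Y)"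
  proof (rule nn_integral_mono)
    fix y assume "y \<in> space (distr M P Y)"
    then have y: "y \<in> space P" by simp
    have "(\<integral>\<^sup>+x. g (y, x) \<partial>distr M Q X) = (\<integral>\<^sup>+\<omega>. g (y, X \<omega>) \<partial>M)"
      using y by (subst nn_integral_distr) auto
    then show "(\<integral>\<^sup>+x. g (y, x) \<partial>distr M Q X) \<le> C" using bound by simp
  qed
  also have "\<dots> = C" by (simp add: Y.emeasure_space_1[simplified])
  finally show ?thesis .
qed

lemma (in prob_space) ridge_form_moment:
  fixes H :: "'b \<Rightarrow> nat \<Rightarrow> 'a \<Rightarrow> complex"
  assumes indep: "indep_vars (\<lambda>_. borel) (\<lambda>(n, i). H n i) (U \<times> {..<N})"
    and n: "n \<in> U" "n \<notin> S" "S \<subseteq> U" "finite S"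
    and wc: "w > 0" "\<And>n. n \<in> S \<Longrightarrow> 0 \<le> c n"
    and col: "white_vector M (H n) N \<kappa>"
  defines "D \<omega> \<equiv> ridge_form N w c (\<lambda>n i. H n i \<omega>) S (\<lambda>i. H n i \<omega>) - ridge_trace N w c (\<lambda>n i. H n i \<omega>) S"
  shows "mom4 M D" "(\<integral>\<omega>. D \<omega> ^ 4 \<partial>M) \<le> (728 * (1 + \<kappa>)\<^sup>2 * N / w\<^sup>2)\<^sup>2"
proof -
  define C where "C = (728 * (1 + \<kappa>)\<^sup>2 * N / w\<^sup>2)\<^sup>2"
  define P where "P = PiM (S \<times> {..<N}) (\<lambda>_. borel :: complex measure)"
  define Q where "Q = PiM ({n} \<times> {..<N}) (\<lambda>_. borel :: complex measure)"
  define X where "X \<omega> = (\<lambda>p\<in>{n} \<times> {..<N}. case p of (n, i) \<Rightarrow> H n i \<omega>)" for \<omega>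
  define Y where "Y \<omega> = (\<lambda>p\<in>S \<times> {..<N}. case p of (n, i) \<Rightarrow> H n i \<omega>)" for \<omega>
  define R where "R y = ridge_inv N w c (\<lambda>n i. y (n, i)) S" for y :: "'b \<times> nat \<Rightarrow> complex"
  define \<Phi> where "\<Phi> z = Re (\<Sum>i<N. \<Sum>j<N. cnj (snd z (n, i)) * R (fst z) i j * snd z (n, j)) - (\<Sum>i<N. Re (R (fst z) i i))"
    for z :: "('b \<times> nat \<Rightarrow> complex) \<times> ('b \<times> nat \<Rightarrow> complex)"
  have "indep_var (PiM (S \<times> {..<N}) (\<lambda>_. borel)) (\<lambda>\<omega>. \<lambda>p\<in>S \<times> {..<N}. (case p of (n, i) \<Rightarrow> H n i) \<omega>)
      (PiM ({n} \<times> {..<N}) (\<lambda>_. borel)) (\<lambda>\<omega>. \<lambda>p\<in>{n} \<times> {..<N}. (case p of (n, i) \<Rightarrow> H n i) \<omega>)"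
    by (rule indep_var_restrict[OF indep]) (use n in auto)
  then have XY: "indep_var P Y Q X"
    unfolding P_def Q_def X_def Y_def by (simp add: split_beta' cong: restrict_cong)
  have R_meas: "(\<lambda>z. R (fst z) i j) \<in> borel_measurable (P \<Otimes>\<^sub>M Q)" if "i < N" "j < N" for i j
  proof -
    have "(\<lambda>y. R y i j) \<in> borel_measurable P"
      unfolding R_def
    proof (rule ridge_inv_measurable[OF wc(1) n(4) wc(2) _ that])
      fix k i assume "k \<in> S" "i < N"
      then show "(\<lambda>y. y (k, i)) \<in> borel_measurable P"
        unfolding P_def by (intro measurable_component_singleton) simp
    qed
    then show ?thesis by (rule measurable_compose[OF measurable_fst])
  qed
  have X_comp: "(\<lambda>z. snd z (n, i)) \<in> borel_measurable (P \<Otimes>\<^sub>M Q)" if "i < N" for i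
  proof -
    have "(\<lambda>x. x (n, i)) \<in> borel_measurable Q"
      unfolding Q_def using that by (intro measurable_component_singleton) simp
    then show ?thesis by (rule measurable_compose[OF measurable_snd])
  qed
  have Re_meas: "(\<lambda>z. Re (f z)) \<in> borel_measurable L" if "f \<in> borel_measurable L"
    for f and L :: "(('b \<times> nat \<Rightarrow> complex) \<times> ('b \<times> nat \<Rightarrow> complex)) measure"
    using that by measurable
  have \<Phi>_meas: "\<Phi> \<in> borel_measurable (P \<Otimes>\<^sub>M Q)"
    unfolding \<Phi>_def[abs_def]
    by (intro borel_measurable_diff Re_meas borel_measurable_sum borel_measurable_times borel_measurable_cnj
        R_meas X_comp) auto
  have D_eq: "D \<omega> = \<Phi> (Y \<omega>, X \<omega>)" for \<omega>
  proof -
    have "R (Y \<omega>) = ridge_inv N w c (\<lambda>n i. H n i \<omega>) S"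
      unfolding R_def by (rule ridge_inv_cong) (simp add: Y_def)
    then show ?thesis
      by (simp add: D_def \<Phi>_def ridge_form_def ridge_trace_def X_def)
  qed
  interpret white_vector M "H n" N \<kappa> by (rule col)
  have bound: "(\<integral>\<^sup>+\<omega>. ennreal (\<Phi> (y, X \<omega>) ^ 4) \<partial>M) \<le> ennreal C" for y
  proof -
    interpret ridge N w c "\<lambda>n i. y (n, i)" S by unfold_locales (use n wc in auto)
    have \<Phi>X: "\<Phi> (y, X \<omega>) = Re (\<Sum>i<N. \<Sum>j<N. cnj (H n i \<omega>) * R y i j * H n j \<omega>) - (\<Sum>i<N. Re (R y i i))" for \<omega>
      by (simp add: \<Phi>_def X_def)
    have herm: "R y i j = cnj (R y j i)" if "i < N" "j < N" for i j
      unfolding R_def by (rule ridge_inv_hermitian[OF subset_refl that])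
    have row: "(\<Sum>j<N. (cmod (R y i j))\<^sup>2) \<le> (1 / w)\<^sup>2" if "i < N" for i
      unfolding R_def by (rule ridge_inv_row[OF subset_refl that])
    have "(\<integral>\<^sup>+\<omega>. ennreal (\<Phi> (y, X \<omega>) ^ 4) \<partial>M) = ennreal (\<integral>\<omega>. \<Phi> (y, X \<omega>) ^ 4 \<partial>M)"
      unfolding \<Phi>X by (rule nn_integral_eq_integral[OF quadratic_form_moment(1)[OF herm row]]) auto
    also have "(\<integral>\<omega>. \<Phi> (y, X \<omega>) ^ 4 \<partial>M) \<le> C"
      unfolding \<Phi>X C_def
      by (rule order_trans[OF quadratic_form_moment(2)[OF herm row]]) (auto simp: power_divide)
    finally show ?thesis using ennreal_leI by blast
  qed
  have nn: "(\<integral>\<^sup>+\<omega>. ennreal (D \<omega> ^ 4) \<partial>M) \<le> ennreal C"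
    unfolding D_eq
    by (rule nn_integral_indep_le[where g = "\<lambda>z. ennreal (\<Phi> z ^ 4)", OF XY _ bound])
       (use \<Phi>_meas in measurable)
  have D_meas: "D \<in> borel_measurable M"
  proof -
    have "Y \<in> measurable M P" "X \<in> measurable M Q" using XY indep_var_rv1 indep_var_rv2 by blast+
    then have "(\<lambda>\<omega>. (Y \<omega>, X \<omega>)) \<in> measurable M (P \<Otimes>\<^sub>M Q)" by (rule measurable_Pair)
    from measurable_compose[OF this \<Phi>_meas] show ?thesis by (simp add: D_eq[abs_def])
  qed
  \<comment> \<open>Integrability of the fourth power is a consequence of the bound just shown, not
    an input to it.\<close>
  have int: "integrable M (\<lambda>\<omega>. D \<omega> ^ 4)"
    by (rule integrableI_nonneg) (use D_meas nn in \<open>auto simp: le_less_trans[OF _ ennreal_less_top]\<close>)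
  then show "mom4 M D" using D_meas by (simp add: mom4_def)
  have "ennreal (\<integral>\<omega>. D \<omega> ^ 4 \<partial>M) \<le> ennreal C"
    using nn nn_integral_eq_integral[OF int] by simp
  then show "(\<integral>\<omega>. D \<omega> ^ 4 \<partial>M) \<le> (728 * (1 + \<kappa>)\<^sup>2 * N / w\<^sup>2)\<^sup>2"
    unfolding C_def by (subst (asm) ennreal_le_iff) simp_all
qed

section \<open>Moments of the Gaussian entries\<close>

lemma (in prob_space) normal_half_moments:
  assumes D: "distributed M lborel Y (normal_density 0 (1 / sqrt 2))"
  shows "integrable M (\<lambda>\<omega>. Y \<omega> ^ (2 * k))"
    and "(\<integral>\<omega>. Y \<omega> ^ (2 * k) \<partial>M) = fact (2 * k) / (4 ^ k * fact k)"
    and "(\<integral>\<omega>. Y \<omega> \<partial>M) = 0"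
proof -
  have sig: "0 < 1 / sqrt 2" by simp
  \<comment> \<open>The base 4 is 2 divided by the variance 1/2.\<close>
  have m: "has_bochner_integral lborel (\<lambda>x. normal_density 0 (1 / sqrt 2) x * x ^ (2 * k)) (fact (2 * k) / (4 ^ k * fact k))"
    using normal_moment_even[OF sig, of 0 k] by (simp add: power_divide)
  show "integrable M (\<lambda>\<omega>. Y \<omega> ^ (2 * k))"
    using distributed_integrable[OF D, of "\<lambda>x. x ^ (2 * k)"] m by (auto simp: has_bochner_integral_iff)
  show "(\<integral>\<omega>. Y \<omega> ^ (2 * k) \<partial>M) = fact (2 * k) / (4 ^ k * fact k)"
    using distributed_integral[OF D, of "\<lambda>x. x ^ (2 * k)"] m by (auto simp: has_bochner_integral_iff)
  show "(\<integral>\<omega>. Y \<omega> \<partial>M) = 0"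
    by (rule normal_distributed_expectation[OF sig D])
qed

text \<open>The value 105 is \<open>8 * (105 / 16 + 105 / 16)\<close>: real and imaginary part have
  eighth moment \<open>105 / 16\<close>, and 8 is the constant of
  \<open>pow4_add_le\<close>.\<close>

lemma (in prob_space) std_complex_normal_white_vector:
  assumes indep: "indep_vars (\<lambda>_. borel) X {..<N}"
    and "\<And>i. i < N \<Longrightarrow> std_complex_normal M (X i)"
  shows "white_vector M X N 105"
proof unfold_locales
  show "indep_vars (\<lambda>_. borel) X {..<N}" by fact
next
  fix i assume i: "i < N"
  then have D: "distributed M lborel (\<lambda>\<omega>. Re (X i \<omega>)) (normal_density 0 (1 / sqrt 2))"
    "distributed M lborel (\<lambda>\<omega>. Im (X i \<omega>)) (normal_density 0 (1 / sqrt 2))"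
    using assms(2) by (auto simp: std_complex_normal_def)
  have [measurable]: "X i \<in> borel_measurable M" using indep i by (auto simp: indep_vars_def)
  show "(\<integral>\<omega>. Re (X i \<omega>) \<partial>M) = 0" "(\<integral>\<omega>. Im (X i \<omega>) \<partial>M) = 0"
    using normal_half_moments(3) D by blast+
  have 2: "integrable M (\<lambda>\<omega>. (Re (X i \<omega>))\<^sup>2)" "(\<integral>\<omega>. (Re (X i \<omega>))\<^sup>2 \<partial>M) = 1 / 2"
    "integrable M (\<lambda>\<omega>. (Im (X i \<omega>))\<^sup>2)" "(\<integral>\<omega>. (Im (X i \<omega>))\<^sup>2 \<partial>M) = 1 / 2"
    using normal_half_moments(1,2)[OF D(1), of 1] normal_half_moments(1,2)[OF D(2), of 1]
    by (simp_all add: fact_numeral)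
  show "(\<integral>\<omega>. (cmod (X i \<omega>))\<^sup>2 \<partial>M) = 1"
    unfolding cmod_power2 using 2 by simp
  have 8: "integrable M (\<lambda>\<omega>. Re (X i \<omega>) ^ 8)" "(\<integral>\<omega>. Re (X i \<omega>) ^ 8 \<partial>M) = 105 / 16"
    "integrable M (\<lambda>\<omega>. Im (X i \<omega>) ^ 8)" "(\<integral>\<omega>. Im (X i \<omega>) ^ 8 \<partial>M) = 105 / 16"
    using normal_half_moments(1,2)[OF D(1), of 4] normal_half_moments(1,2)[OF D(2), of 4]
    by (simp_all add: fact_numeral)
  have eq: "cmod z ^ 8 = ((Re z)\<^sup>2 + (Im z)\<^sup>2) ^ 4" for z
    unfolding cmod_power2[symmetric] by (simp add: power_mult[symmetric])
  have le: "cmod z ^ 8 \<le> 8 * (Re z ^ 8 + Im z ^ 8)" for z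
    using pow4_add_le[of "(Re z)\<^sup>2" "(Im z)\<^sup>2"] unfolding eq by (simp add: power_mult[symmetric])
  have bnd: "integrable M (\<lambda>\<omega>. 8 * (Re (X i \<omega>) ^ 8 + Im (X i \<omega>) ^ 8))" using 8 by simp
  show int: "integrable M (\<lambda>\<omega>. cmod (X i \<omega>) ^ 8)"
  proof (rule Bochner_Integration.integrable_bound[OF bnd])
    show "AE \<omega> in M. norm (cmod (X i \<omega>) ^ 8) \<le> norm (8 * (Re (X i \<omega>) ^ 8 + Im (X i \<omega>) ^ 8))"
      using le order_trans[OF _ abs_ge_self] by (intro AE_I2) (auto simp del: distrib_left_numeral)
  qed simp
  have "(\<integral>\<omega>. cmod (X i \<omega>) ^ 8 \<partial>M) \<le> (\<integral>\<omega>. 8 * (Re (X i \<omega>) ^ 8 + Im (X i \<omega>) ^ 8) \<partial>M)"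
    by (rule integral_mono[OF int bnd le])
  also have "\<dots> = 105" using 8 by simp
  finally show "(\<integral>\<omega>. cmod (X i \<omega>) ^ 8 \<partial>M) \<le> 105" .
qed

text \<open>Summable expectations make the series of fourth powers almost surely finite, so its
  terms tend to zero; this takes the place of a Borel-Cantelli argument.\<close>

lemma AE_tendsto_0_of_fourth_moments:
  assumes "\<And>n. n \<ge> n0 \<Longrightarrow> mom4 M (X n)" "\<And>n. n \<ge> n0 \<Longrightarrow> (\<integral>\<omega>. X n \<omega> ^ 4 \<partial>M) \<le> b n"
    and b: "summable b" "\<And>n. 0 \<le> b n"
  shows "AE \<omega> in M. (\<lambda>n. X n \<omega>) \<longlonglongrightarrow> 0"
proof -
  define Y where "Y n \<omega> = (if n \<ge> n0 then X n \<omega> else 0)" for n \<omega>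
  have Y: "mom4 M (Y n)" "(\<integral>\<omega>. Y n \<omega> ^ 4 \<partial>M) \<le> b n" for n
    using assms by (cases "n \<ge> n0"; simp add: Y_def[abs_def] mom4_zero)+
  have [measurable]: "Y n \<in> borel_measurable M" for n using Y(1)[of n] by (simp add: mom4_def)
  have "(\<integral>\<^sup>+\<omega>. (\<Sum>n. ennreal (Y n \<omega> ^ 4)) \<partial>M) = (\<Sum>n. \<integral>\<^sup>+\<omega>. ennreal (Y n \<omega> ^ 4) \<partial>M)"
    by (rule nn_integral_suminf) simp
  also have "\<dots> \<le> (\<Sum>n. ennreal (b n))"
  proof (rule suminf_le)
    fix n
    have "(\<integral>\<^sup>+\<omega>. ennreal (Y n \<omega> ^ 4) \<partial>M) = ennreal (\<integral>\<omega>. Y n \<omega> ^ 4 \<partial>M)"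
      using Y(1)[of n] by (intro nn_integral_eq_integral) (auto simp: mom4_def)
    then show "(\<integral>\<^sup>+\<omega>. ennreal (Y n \<omega> ^ 4) \<partial>M) \<le> ennreal (b n)"
      using Y(2)[of n] by (simp add: ennreal_leI)
  qed auto
  also have "\<dots> = ennreal (\<Sum>n. b n)" using b by (intro suminf_ennreal2) auto
  also have "\<dots> < \<infinity>" by simp
  finally have "(\<integral>\<^sup>+\<omega>. (\<Sum>n. ennreal (Y n \<omega> ^ 4)) \<partial>M) \<noteq> \<infinity>"
    by (rule less_imp_neq)
  then have "AE \<omega> in M. (\<Sum>n. ennreal (Y n \<omega> ^ 4)) \<noteq> \<infinity>"
    by (rule nn_integral_PInf_AE[rotated]) simp
  then show ?thesis
  proof (rule AE_mp, intro AE_I2 impI)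
    fix \<omega> assume "(\<Sum>n. ennreal (Y n \<omega> ^ 4)) \<noteq> \<infinity>"
    then have "summable (\<lambda>n. Y n \<omega> ^ 4)" by (intro summable_suminf_not_top) auto
    then have "(\<lambda>n. Y n \<omega> ^ 4) \<longlonglongrightarrow> 0" by (rule summable_LIMSEQ_zero)
    then have "(\<lambda>n. \<bar>Y n \<omega>\<bar> ^ 4) \<longlonglongrightarrow> 0" by (simp add: power_even_abs)
    then have "(\<lambda>n. root 4 (\<bar>Y n \<omega>\<bar> ^ 4)) \<longlonglongrightarrow> root 4 0" by (rule tendsto_real_root)
    moreover have "root 4 (\<bar>Y n \<omega>\<bar> ^ 4) = \<bar>Y n \<omega>\<bar>" for n
      by (rule real_root_power_cancel) simp_all
    ultimately have "(\<lambda>n. \<bar>Y n \<omega>\<bar>) \<longlonglongrightarrow> 0" by (simp only: real_root_zero)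
    then have "(\<lambda>n. Y n \<omega>) \<longlonglongrightarrow> 0" by (simp add: tendsto_rabs_zero_iff)
    moreover have "eventually (\<lambda>n. Y n \<omega> = X n \<omega>) sequentially"
      using eventually_ge_at_top[of n0] by eventually_elim (simp add: Y_def)
    ultimately show "(\<lambda>n. X n \<omega>) \<longlonglongrightarrow> 0" by (rule Lim_transform_eventually)
  qed
qed

text \<open>Cauchy-Schwarz, applied to \<open>f\<close> and then to its squares.\<close>

lemma sum_pow4_le:
  fixes f :: "'i \<Rightarrow> real"
  shows "(\<Sum>i\<in>A. f i) ^ 4 \<le> real (card A) ^ 3 * (\<Sum>i\<in>A. f i ^ 4)"
proof -
  have "((\<Sum>i\<in>A. f i)\<^sup>2)\<^sup>2 \<le> ((\<Sum>i\<in>A. (f i)\<^sup>2) * real (card A))\<^sup>2"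
    by (rule power_mono[OF sum_squared_le_sum_of_squares]) simp
  also have "\<dots> = (\<Sum>i\<in>A. (f i)\<^sup>2)\<^sup>2 * (real (card A))\<^sup>2" by (simp only: power_mult_distrib)
  also have "\<dots> \<le> ((\<Sum>i\<in>A. ((f i)\<^sup>2)\<^sup>2) * real (card A)) * (real (card A))\<^sup>2"
    by (rule mult_right_mono[OF sum_squared_le_sum_of_squares]) simp
  finally show ?thesis by (simp add: power3_eq_cube power2_eq_square mult_ac power4_eq_xxxx)
qed

section \<open>The fixed-point equation\<close>

text \<open>With \<open>a n = q n * d (fst m) n\<close>, the equation \<open>dual_load (w m) N a (U - {m}) \<beta> = 1\<close> is the
  fixed-point equation for \<open>\<gamma> = a m * \<beta>\<close>.\<close>

definition dual_load :: "real \<Rightarrow> nat \<Rightarrow> ('b \<Rightarrow> real) \<Rightarrow> 'b set \<Rightarrow> real \<Rightarrow> real" where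
  "dual_load w N a S t = w * t + (1 / real N) * (\<Sum>n\<in>S. a n * t / (1 + a n * t))"

text \<open>The slope of \<open>a * t / (1 + a * t)\<close> in \<open>t\<close> is
  \<open>a / (1 + a * t)\<^sup>2\<close>, which lies between 0 and \<open>a\<close>; both
  consequences are derived from the explicit difference.\<close>

lemma saturation_diff:
  fixes a s t :: real
  assumes "0 \<le> a" "0 \<le> s" "0 \<le> t"
  shows "\<bar>a * t / (1 + a * t) - a * s / (1 + a * s)\<bar> \<le> a * \<bar>t - s\<bar>"
    and "s \<le> t \<Longrightarrow> a * s / (1 + a * s) \<le> a * t / (1 + a * t)"
proof -
  have pos: "1 \<le> 1 + a * t" "1 \<le> 1 + a * s" using assms by simp_all
  have eq: "a * t / (1 + a * t) - a * s / (1 + a * s) = a * (t - s) / ((1 + a * t) * (1 + a * s))"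
    using pos diff_frac_eq[of "1 + a * t" "1 + a * s" "a * t" "a * s"] by (simp add: algebra_simps)
  have ge: "1 \<le> (1 + a * t) * (1 + a * s)" using mult_mono[OF pos] pos by simp
  have "\<bar>a * t / (1 + a * t) - a * s / (1 + a * s)\<bar> = a * \<bar>t - s\<bar> / ((1 + a * t) * (1 + a * s))"
    unfolding eq using ge assms by (simp add: abs_mult)
  also have "\<dots> \<le> a * \<bar>t - s\<bar> / 1" using ge assms by (intro divide_left_mono) auto
  finally show "\<bar>a * t / (1 + a * t) - a * s / (1 + a * s)\<bar> \<le> a * \<bar>t - s\<bar>" by simp
  assume "s \<le> t"
  then have "0 \<le> a * (t - s) / ((1 + a * t) * (1 + a * s))" using ge assms by simp
  then show "a * s / (1 + a * s) \<le> a * t / (1 + a * t)" unfolding eq[symmetric] by simp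
qed

lemma dual_load_increment:
  assumes "w > 0" "\<And>n. n \<in> S \<Longrightarrow> 0 \<le> a n" "0 \<le> s" "s \<le> t"
  shows "w * (t - s) \<le> dual_load w N a S t - dual_load w N a S s"
proof -
  have "(\<Sum>n\<in>S. a n * s / (1 + a n * s)) \<le> (\<Sum>n\<in>S. a n * t / (1 + a n * t))"
    using assms by (intro sum_mono saturation_diff(2)) auto
  then have "(1 / real N) * (\<Sum>n\<in>S. a n * s / (1 + a n * s)) \<le> (1 / real N) * (\<Sum>n\<in>S. a n * t / (1 + a n * t))"
    by (intro mult_left_mono) auto
  then show ?thesis by (simp add: dual_load_def algebra_simps)
qed

text \<open>Stability: a small residual in the equation means a small distance from the solution.
  The same inequality yields uniqueness.\<close>

lemma dual_load_distance:
  assumes "w > 0" "\<And>n. n \<in> S \<Longrightarrow> 0 \<le> a n" "0 \<le> s" "0 \<le> t"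
  shows "w * \<bar>t - s\<bar> \<le> \<bar>dual_load w N a S t - dual_load w N a S s\<bar>"
proof (cases "s \<le> t")
  case True
  then show ?thesis
    using dual_load_increment[where s = s and t = t and N = N and S = S and a = a, OF assms(1,2,3)] by (simp add: abs_of_nonneg)
next
  case False
  then show ?thesis
    using dual_load_increment[where s = t and t = s and N = N and S = S and a = a, OF assms(1,2,4)] by (simp add: abs_of_nonpos)
qed

lemma dual_load_eq_1_exists:
  assumes "w > 0" "\<And>n. n \<in> S \<Longrightarrow> 0 \<le> a n"
  obtains \<beta> where "\<beta> > 0" "dual_load w N a S \<beta> = 1"
proof -
  have "continuous_on {0..1 / w} (dual_load w N a S)"
    unfolding dual_load_def[abs_def]
  proof (intro continuous_intros ballI)
    fix n t assume "n \<in> S" "t \<in> {0..1 / w}"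
    then have "0 \<le> a n * t" using assms by simp
    then show "1 + a n * t \<noteq> 0" by linarith
  qed
  moreover have 0: "dual_load w N a S 0 = 0" by (simp add: dual_load_def)
  \<comment> \<open>At \<open>1 / w\<close> the linear term alone reaches 1, so the intermediate
    value theorem applies on the interval from 0 to \<open>1 / w\<close>.\<close>
  moreover have "1 \<le> dual_load w N a S (1 / w)"
    using dual_load_increment[where s = 0 and t = "1 / w" and N = N and S = S and a = a, OF assms] assms(1) 0 by simp
  ultimately obtain \<beta> where "0 \<le> \<beta>" "dual_load w N a S \<beta> = 1"
    using IVT'[of "dual_load w N a S" 0 1 "1 / w"] assms(1) by auto
  moreover from this 0 have "\<beta> \<noteq> 0" by auto
  ultimately show ?thesis using that[of \<beta>] by simp
qed

text \<open>The deterministic half of the argument. As \<open>c n\<close> carries a factor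
  \<open>1 / N\<close>, the coefficient \<open>a n\<close> is \<open>N * c n\<close>. The second
  summand bounds the residual of the normalised trace in the equation, divided by the slope
  \<open>w\<close>.\<close>

lemma (in ridge) ridge_form_deviation:
  assumes N: "N > 0" and S: "S \<subseteq> T" "m \<notin> S" and \<beta>: "0 \<le> \<beta>" "dual_load w N (\<lambda>n. N * c n) S \<beta> = 1"
    and C: "0 \<le> C" "\<And>n. n \<in> S \<Longrightarrow> N * c n \<le> C"
  defines "D n \<equiv> ridge_form N w c h (S - {n}) (h n) - ridge_trace N w c h (S - {n})"
  shows "\<bar>ridge_form N w c h S (h m) / N - \<beta>\<bar> \<le>
    \<bar>D m\<bar> / N + C / w * ((\<Sum>n\<in>S. \<bar>D n\<bar>) / (real N)\<^sup>2 + card S / (w * (real N)\<^sup>2))"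
proof -
  define t where "t = ridge_trace N w c h S / N"
  define s where "s n = ridge_form N w c h (S - {n}) (h n) / N" for n
  define a where "a n = N * c n" for n
  have a0: "0 \<le> a n" "a n \<le> C" if "n \<in> S" for n using that C c_nonneg S by (auto simp: a_def)
  have t0: "0 \<le> t" using ridge_trace_nonneg[OF S(1)] by (simp add: t_def)
  have sub: "S - {n} \<subseteq> T" for n using S by auto
  have s0: "0 \<le> s n" for n using ridge_form_nonneg[OF sub] by (simp add: s_def)
  have form: "c n * ridge_form N w c h S (h n) = a n * s n / (1 + a n * s n)" if "n \<in> S" for n
    using ridge_form_insert[of n "S - {n}"] that S N by (simp add: insert_absorb a_def s_def)
  have "w * (N * t) + (\<Sum>n\<in>S. a n * s n / (1 + a n * s n)) = N"
    using ridge_trace_identity[OF S(1)] N form by (simp add: t_def)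
  then have one: "w * t + (1 / N) * (\<Sum>n\<in>S. a n * s n / (1 + a n * s n)) = 1"
    using N by (simp add: field_simps)
  have dist: "\<bar>t - s n\<bar> \<le> \<bar>D n\<bar> / N + 1 / (w * N)" if "n \<in> S" for n
  proof -
    have "\<bar>ridge_trace N w c h S - ridge_trace N w c h (S - {n})\<bar> \<le> 1 / w"
      using ridge_trace_insert[of n "S - {n}"] that S by (simp add: insert_absorb)
    then have "\<bar>ridge_trace N w c h S - ridge_form N w c h (S - {n}) (h n)\<bar> \<le> \<bar>D n\<bar> + 1 / w"
      unfolding D_def by linarith
    then have "\<bar>ridge_trace N w c h S - ridge_form N w c h (S - {n}) (h n)\<bar> / N \<le> (\<bar>D n\<bar> + 1 / w) / N"
      by (rule divide_right_mono) simp
    moreover have "\<bar>ridge_trace N w c h S - ridge_form N w c h (S - {n}) (h n)\<bar> / N = \<bar>t - s n\<bar>"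
      by (simp add: t_def s_def diff_divide_distrib[symmetric])
    ultimately show ?thesis by (simp add: add_divide_distrib)
  qed
  have each: "\<bar>a n * t / (1 + a n * t) - a n * s n / (1 + a n * s n)\<bar> \<le> C * (\<bar>D n\<bar> / N + 1 / (w * N))" if "n \<in> S" for n
  proof -
    have "\<bar>a n * t / (1 + a n * t) - a n * s n / (1 + a n * s n)\<bar> \<le> a n * \<bar>t - s n\<bar>"
      using saturation_diff(1) a0 that s0 t0 by blast
    also have "\<dots> \<le> C * (\<bar>D n\<bar> / N + 1 / (w * N))"
      using a0[OF that] dist[OF that] C by (intro mult_mono) auto
    finally show ?thesis .
  qed
  have "dual_load w N a S t - 1 = (1 / N) * (\<Sum>n\<in>S. a n * t / (1 + a n * t) - a n * s n / (1 + a n * s n))"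
    using one by (simp add: dual_load_def sum_subtractf right_diff_distrib)
  then have "\<bar>dual_load w N a S t - 1\<bar> = (1 / N) * \<bar>\<Sum>n\<in>S. a n * t / (1 + a n * t) - a n * s n / (1 + a n * s n)\<bar>"
    by (simp add: abs_mult)
  also have "\<dots> \<le> (1 / N) * (\<Sum>n\<in>S. C * (\<bar>D n\<bar> / N + 1 / (w * N)))"
    by (intro mult_left_mono order_trans[OF sum_abs] sum_mono each) auto
  also have "(\<Sum>n\<in>S. C * (\<bar>D n\<bar> / N + 1 / (w * N))) = C * ((\<Sum>n\<in>S. \<bar>D n\<bar>) / N + card S * (1 / (w * N)))"
    unfolding sum_distrib_left[symmetric] sum.distrib sum_divide_distrib[symmetric] by simp
  also have "(1 / N) * \<dots> = C * ((\<Sum>n\<in>S. \<bar>D n\<bar>) / (real N)\<^sup>2 + card S / (w * (real N)\<^sup>2))"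
    using N w_pos by (simp add: power2_eq_square divide_simps)
  finally have F: "\<bar>dual_load w N a S t - dual_load w N a S \<beta>\<bar> \<le> C * ((\<Sum>n\<in>S. \<bar>D n\<bar>) / (real N)\<^sup>2 + card S / (w * (real N)\<^sup>2))"
    using \<beta>(2) by (simp add: a_def[abs_def])
  have "w * \<bar>t - \<beta>\<bar> \<le> \<bar>dual_load w N a S t - dual_load w N a S \<beta>\<bar>"
    by (rule dual_load_distance[OF w_pos a0(1) \<beta>(1) t0])
  also note F
  finally have "\<bar>t - \<beta>\<bar> \<le> C / w * ((\<Sum>n\<in>S. \<bar>D n\<bar>) / (real N)\<^sup>2 + card S / (w * (real N)\<^sup>2))"
    using w_pos by (simp add: pos_le_divide_eq mult.commute)
  \<comment> \<open>As \<open>m\<close> is not in \<open>S\<close>, the set \<open>S - {m}\<close>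
    is \<open>S\<close>, and \<open>D m\<close> compares the form at \<open>h m\<close> with the
    trace of the full inverse.\<close>
  moreover have "\<bar>ridge_form N w c h S (h m) / N - t\<bar> = \<bar>D m\<bar> / N"
    using S(2) by (simp add: D_def t_def diff_divide_distrib[symmetric])
  ultimately show ?thesis by linarith
qed

section \<open>Convergence of the SINR\<close>

text \<open>Each new variable is a function of the block \<open>{f j}\<close>; injectivity makes the
  blocks disjoint.\<close>

lemma (in prob_space) indep_vars_reindex:
  assumes indep: "indep_vars (\<lambda>_. B) X I" and f: "inj_on f L" "f ` L \<subseteq> I"
  shows "indep_vars (\<lambda>_. B) (\<lambda>j. X (f j)) L"
proof -
  have "indep_vars (\<lambda>j. PiM {f j} (\<lambda>_. B)) (\<lambda>j \<omega>. restrict (\<lambda>i. X i \<omega>) {f j}) L"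
    by (rule indep_vars_restrict[OF indep])
       (use f in \<open>auto simp: disjoint_family_on_def inj_on_def\<close>)
  then have "indep_vars (\<lambda>_. B) (\<lambda>j \<omega>. (\<lambda>x. x (f j)) (restrict (\<lambda>i. X i \<omega>) {f j})) L"
    by (rule indep_vars_compose2) simp
  then show ?thesis by simp
qed

text \<open>Substituting \<open>A * \<beta>\<close> cancels \<open>A\<close> in every summand: the
  right-hand side becomes \<open>A / G\<close> with a denominator \<open>G\<close> for which
  \<open>\<beta> * G\<close> is the load.\<close>

lemma fixed_point_rhs_iff:
  assumes "0 < N" "0 < w m" "0 < q m * d (fst m) m" "0 < \<beta>"
    and nonneg: "\<And>n. n \<in> U - {m} \<Longrightarrow> 0 \<le> q n * d (fst m) n"
  defines "A \<equiv> q m * d (fst m) m"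
  shows "A * \<beta> = fixed_point_rhs N U d w q m (A * \<beta>) \<longleftrightarrow>
    dual_load (w m) N (\<lambda>n. q n * d (fst m) n) (U - {m}) \<beta> = 1"
proof -
  define G where "G = w m + (1 / real N) * (\<Sum>n\<in>U - {m}. q n * d (fst m) n / (1 + q n * d (fst m) n * \<beta>))"
  have A: "A > 0" using assms by simp
  have summand: "q n * q m * d (fst m) n * d (fst m) m / (q m * d (fst m) m + q n * d (fst m) n * (A * \<beta>)) =
      q n * d (fst m) n / (1 + q n * d (fst m) n * \<beta>)" for n
  proof -
    have *: "q n * q m * d (fst m) n * d (fst m) m = A * (q n * d (fst m) n)"
      "q m * d (fst m) m + q n * d (fst m) n * (A * \<beta>) = A * (1 + q n * d (fst m) n * \<beta>)"
      by (simp_all add: A_def algebra_simps)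
    show ?thesis unfolding * using A by simp
  qed
  have rhs: "fixed_point_rhs N U d w q m (A * \<beta>) = A / G"
    unfolding fixed_point_rhs_def summand G_def by (simp add: A_def)
  have "0 \<le> (\<Sum>n\<in>U - {m}. q n * d (fst m) n / (1 + q n * d (fst m) n * \<beta>))"
  proof (rule sum_nonneg)
    fix n assume "n \<in> U - {m}"
    then have a: "0 \<le> q n * d (fst m) n" by (rule nonneg)
    then have "0 \<le> q n * d (fst m) n * \<beta>" using mult_nonneg_nonneg[OF a] assms(4) by simp
    then show "0 \<le> q n * d (fst m) n / (1 + q n * d (fst m) n * \<beta>)"
      using divide_nonneg_nonneg[OF a] by simp
  qed
  then have "G > 0" using assms(1,2) unfolding G_def by (intro add_pos_nonneg) auto
  then have "A * \<beta> = A / G \<longleftrightarrow> \<beta> * G = 1" using A by (auto simp: field_simps)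
  moreover have "\<beta> * G = dual_load (w m) N (\<lambda>n. q n * d (fst m) n) (U - {m}) \<beta>"
    unfolding G_def dual_load_def by (simp add: distrib_left sum_distrib_left mult_ac)
  ultimately show ?thesis unfolding rhs by simp
qed

lemma SINR_DN_ridge_form:
  assumes N: "0 < N" and w: "0 < w m" and U: "finite U"
    and nonneg: "\<And>n. n \<in> U - {m} \<Longrightarrow> 0 \<le> q n * d (fst m) n"
  shows "SINR_DN N U d w q (\<lambda>b n. vec N (G b n)) m = complex_of_real (q m * d (fst m) m *
    (ridge_form N (w m) (\<lambda>n. q n * d (fst m) n / N) (G (fst m)) (U - {m}) (G (fst m) m) / N))"
proof -
  define c where "c n = q n * d (fst m) n / real N" for n
  define g where "g = G (fst m)"
  interpret ridge N "w m" c g "U - {m}"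
    by unfold_locales (use assms in \<open>auto simp: c_def\<close>)
  have mat: "interference_matrix N U d w q (\<lambda>b n. vec N (G b n)) m = ridge_mat N (w m) c g (U - {m})"
    by (rule eq_matI) (auto simp: interference_matrix_def ridge_mat_def ridge_entry_def c_def g_def)
  obtain R where R: "mat_inverse (ridge_mat N (w m) c g (U - {m})) = Some R" "R \<in> carrier_mat N N"
    using ridge_mat_inverse[OF subset_refl] by metis
  have entry: "(R *\<^sub>v vec N (g m)) $ i = sol (U - {m}) (g m) i" if "i < N" for i
    using R that by (simp add: scalar_prod_def sol_def ridge_inv_def lessThan_atLeast0)
  \<comment> \<open>\<open>\<bullet>c\<close> conjugates its second argument, \<open>cip\<close> its
    first.\<close>
  have "(R *\<^sub>v vec N (g m)) \<bullet>c vec N (g m) = (\<Sum>i<N. sol (U - {m}) (g m) i * cnj (g m i))"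
    unfolding scalar_prod_def using R(2) entry by (simp add: lessThan_atLeast0)
  also have "\<dots> = cip N (g m) (sol (U - {m}) (g m))" by (simp add: cip_def mult.commute)
  also have "\<dots> = of_real (ridge_form N (w m) c g (U - {m}) (g m))"
    by (rule cip_sol_eq_ridge_form) simp
  finally have inner: "(R *\<^sub>v vec N (g m)) \<bullet>c vec N (g m) = of_real (ridge_form N (w m) c g (U - {m}) (g m))" .
  have c_eq: "(\<lambda>n. q n * d (fst m) n / N) = c" by (simp add: c_def[abs_def])
  show ?thesis
    unfolding SINR_DN_def mat R(1) option.sel g_def[symmetric] c_eq inner by simp
qed

lemma deviation_moment:
  fixes D :: "'b \<Rightarrow> 'a \<Rightarrow> real"
  assumes D: "\<And>n. n \<in> insert m S \<Longrightarrow> mom4 M (D n)"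
    "\<And>n. n \<in> insert m S \<Longrightarrow> (\<integral>\<omega>. D n \<omega> ^ 4 \<partial>M) \<le> (V * real N)\<^sup>2"
    and N: "N > 0" and S: "finite S" "card S \<le> \<rho> * real N" and e: "0 \<le> e"
  defines "X \<omega> \<equiv> \<bar>D m \<omega>\<bar> / N + e * ((\<Sum>n\<in>S. \<bar>D n \<omega>\<bar>) / (real N)\<^sup>2)"
  shows "mom4 M X" "(\<integral>\<omega>. X \<omega> ^ 4 \<partial>M) \<le> 8 * V\<^sup>2 * (1 + e ^ 4 * \<rho> ^ 4) * inverse (real N ^ 2)"
proof -
  have absD: "mom4 M (\<lambda>\<omega>. \<bar>D n \<omega>\<bar>)" if "n \<in> insert m S" for n
    using D(1)[OF that] by (auto simp: mom4_def)
  define P where "P \<omega> = (1 / N) * \<bar>D m \<omega>\<bar>" for \<omega>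
  define s where "s \<omega> = (\<Sum>n\<in>S. \<bar>D n \<omega>\<bar>)" for \<omega>
  define Q where "Q \<omega> = (e / (real N)\<^sup>2) * s \<omega>" for \<omega>
  have X: "X = (\<lambda>\<omega>. P \<omega> + Q \<omega>)" by (rule ext) (simp add: X_def P_def Q_def s_def)
  have P: "mom4 M P" unfolding P_def[abs_def] by (rule mom4_cmult[OF absD]) simp
  have s: "mom4 M s" unfolding s_def[abs_def] by (rule mom4_sum[OF absD]) simp
  have Q: "mom4 M Q" unfolding Q_def[abs_def] by (rule mom4_cmult[OF s])
  show "mom4 M X" unfolding X by (rule mom4_add[OF P Q])
  have P4: "(\<integral>\<omega>. P \<omega> ^ 4 \<partial>M) \<le> V\<^sup>2 * inverse (real N ^ 2)"
  proof -
    have "(\<integral>\<omega>. P \<omega> ^ 4 \<partial>M) = (1 / N) ^ 4 * (\<integral>\<omega>. D m \<omega> ^ 4 \<partial>M)"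
      by (simp add: P_def power_mult_distrib power_divide)
    also have "\<dots> \<le> (1 / N) ^ 4 * (V * real N)\<^sup>2" by (rule mult_left_mono[OF D(2)]) simp_all
    also have "\<dots> = V\<^sup>2 * inverse (real N ^ 2)" using N by (simp add: field_simps eval_nat_numeral)
    finally show ?thesis .
  qed
  have s4: "(\<integral>\<omega>. s \<omega> ^ 4 \<partial>M) \<le> (\<rho> * real N) ^ 4 * (V * real N)\<^sup>2"
  proof -
    have int: "integrable M (\<lambda>\<omega>. D n \<omega> ^ 4)" if "n \<in> S" for n using D(1)[of n] that by (simp add: mom4_def)
    have "(\<integral>\<omega>. s \<omega> ^ 4 \<partial>M) \<le> (\<integral>\<omega>. real (card S) ^ 3 * (\<Sum>n\<in>S. D n \<omega> ^ 4) \<partial>M)"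
    proof (rule integral_mono)
      show "integrable M (\<lambda>\<omega>. s \<omega> ^ 4)" using s by (simp add: mom4_def)
      show "integrable M (\<lambda>\<omega>. real (card S) ^ 3 * (\<Sum>n\<in>S. D n \<omega> ^ 4))"
        using int by (intro integrable_mult_right Bochner_Integration.integrable_sum) auto
      show "s \<omega> ^ 4 \<le> real (card S) ^ 3 * (\<Sum>n\<in>S. D n \<omega> ^ 4)" for \<omega>
        using sum_pow4_le[of "\<lambda>n. \<bar>D n \<omega>\<bar>" S] by (simp add: s_def)
    qed
    also have "\<dots> = real (card S) ^ 3 * (\<Sum>n\<in>S. \<integral>\<omega>. D n \<omega> ^ 4 \<partial>M)"
      using int by (simp add: Bochner_Integration.integral_sum)
    also have "\<dots> \<le> real (card S) ^ 3 * (\<Sum>n\<in>S. (V * real N)\<^sup>2)"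
      by (intro mult_left_mono sum_mono D(2)) auto
    also have "\<dots> = real (card S) ^ 4 * (V * real N)\<^sup>2" by (simp add: eval_nat_numeral)
    also have "\<dots> \<le> (\<rho> * real N) ^ 4 * (V * real N)\<^sup>2"
      using S(2) by (intro mult_right_mono power_mono) auto
    finally show ?thesis .
  qed
  have Q4: "(\<integral>\<omega>. Q \<omega> ^ 4 \<partial>M) \<le> V\<^sup>2 * (e ^ 4 * \<rho> ^ 4) * inverse (real N ^ 2)"
  proof -
    have "(\<integral>\<omega>. Q \<omega> ^ 4 \<partial>M) = (e / (real N)\<^sup>2) ^ 4 * (\<integral>\<omega>. s \<omega> ^ 4 \<partial>M)"
      by (simp add: Q_def power_mult_distrib power_divide)
    also have "\<dots> \<le> (e / (real N)\<^sup>2) ^ 4 * ((\<rho> * real N) ^ 4 * (V * real N)\<^sup>2)"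
      by (rule mult_left_mono[OF s4]) simp
    also have "\<dots> = V\<^sup>2 * (e ^ 4 * \<rho> ^ 4) * inverse (real N ^ 2)"
      using N by (simp add: field_simps eval_nat_numeral)
    finally show ?thesis .
  qed
  have "(\<integral>\<omega>. X \<omega> ^ 4 \<partial>M) \<le> 8 * ((\<integral>\<omega>. P \<omega> ^ 4 \<partial>M) + (\<integral>\<omega>. Q \<omega> ^ 4 \<partial>M))"
    unfolding X by (rule expectation_pow4_add_le[OF P Q])
  also have "\<dots> \<le> 8 * (V\<^sup>2 * inverse (real N ^ 2) + V\<^sup>2 * (e ^ 4 * \<rho> ^ 4) * inverse (real N ^ 2))"
    by (intro mult_left_mono add_mono P4 Q4) simp
  also have "\<dots> = 8 * V\<^sup>2 * (1 + e ^ 4 * \<rho> ^ 4) * inverse (real N ^ 2)"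
    by (simp add: algebra_simps)
  finally show "(\<integral>\<omega>. X \<omega> ^ 4 \<partial>M) \<le> 8 * V\<^sup>2 * (1 + e ^ 4 * \<rho> ^ 4) * inverse (real N ^ 2)" .
qed

text \<open>\<gamma> is constrained pointwise only at those \<open>N\<close> at which
  \<open>m\<close> is a user, which is the case for all large \<open>N\<close>. The clause on
  \<open>x\<close> adds that the equation has no other positive solution there.\<close>

theorem lemma1:
  fixes M :: "'a measure"
    and J :: nat
    and K :: "nat \<Rightarrow> nat"
    and d :: "nat \<Rightarrow> nat \<Rightarrow> user \<Rightarrow> real"
    and w :: "user \<Rightarrow> real"
    and q :: "nat \<Rightarrow> user \<Rightarrow> real"
    and H :: "nat \<Rightarrow> nat \<Rightarrow> user \<Rightarrow> nat \<Rightarrow> 'a \<Rightarrow> complex"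
    and m :: user
  assumes "prob_space M"
    and "filterlim K at_top sequentially"
    and "liminf (\<lambda>N. ereal (real (K N) / real N)) > 0"
    and "limsup (\<lambda>N. ereal (real (K N) / real N)) < \<infinity>"
    and "\<And>n. n \<in> {1..J} \<times> {1..} \<Longrightarrow> w n > 0"
    and "\<And>N n. N > 0 \<Longrightarrow> n \<in> users J (K N) \<Longrightarrow> q N n > 0"
    and "\<And>N b n. N > 0 \<Longrightarrow> b \<in> {1..J} \<Longrightarrow> n \<in> users J (K N) \<Longrightarrow> d N b n > 0"
    and "bdd_above {q N n * d N b n | N b n. N > 0 \<and> b \<in> {1..J} \<and> n \<in> users J (K N)}"
    and "\<And>N b n i. N > 0 \<Longrightarrow> b \<in> {1..J} \<Longrightarrow> n \<in> users J (K N) \<Longrightarrow> i < N \<Longrightarrow>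
           std_complex_normal M (H N b n i)"
    and "\<And>N. N > 0 \<Longrightarrow>
           prob_space.indep_vars M (\<lambda>_. borel) (\<lambda>(b, n, i). H N b n i)
             ({1..J} \<times> users J (K N) \<times> {..<N})"
    and "m \<in> {1..J} \<times> {1..}"
  shows "\<exists>\<gamma> :: nat \<Rightarrow> real.
           (\<forall>N > 0. m \<in> users J (K N) \<longrightarrow>
              \<gamma> N > 0 \<and>
              \<gamma> N = fixed_point_rhs N (users J (K N)) (d N) w (q N) m (\<gamma> N) \<and>
              (\<forall>x > 0. x = fixed_point_rhs N (users J (K N)) (d N) w (q N) m x \<longrightarrow> x = \<gamma> N)) \<and>
           (AE \<omega> in M.
              (\<lambda>N. SINR_DN N (users J (K N)) (d N) w (q N) (\<lambda>b n. vec N (\<lambda>i. H N b n i \<omega>)) m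
                     - complex_of_real (\<gamma> N)) \<longlonglongrightarrow> 0)"
proof -
  interpret prob_space M by fact
  define b where "b = fst m"
  define U where "U N = users J (K N)" for N
  define S where "S N = U N - {m}" for N
  define \<alpha> where "\<alpha> N n = q N n * d N b n" for N n
  have b: "b \<in> {1..J}" and w: "0 < w m" using assms(5,11) by (auto simp: b_def)
  have finU: "finite (U N)" for N by (simp add: U_def users_def)
  have \<alpha>_pos: "0 < \<alpha> N n" if "0 < N" "n \<in> U N" for N n
    using that assms(6)[of N n] assms(7)[of N b n] b by (simp add: \<alpha>_def U_def)
  obtain C0 where C0: "\<And>x. x \<in> {q N n * d N b n | N b n. N > 0 \<and> b \<in> {1..J} \<and> n \<in> users J (K N)} \<Longrightarrow> x \<le> C0"
    using assms(8) unfolding bdd_above_def by blast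
  \<comment> \<open>The maximum with 0 supplies the sign that the deviation bound asks for.\<close>
  define C where "C = max 0 C0"
  have C: "0 \<le> C" by (simp add: C_def)
  have \<alpha>_le: "\<alpha> N n \<le> C" if "0 < N" "n \<in> U N" for N n
  proof -
    have "\<alpha> N n \<in> {q N n * d N b n | N b n. N > 0 \<and> b \<in> {1..J} \<and> n \<in> users J (K N)}"
      using that b unfolding \<alpha>_def U_def by blast
    from C0[OF this] show ?thesis by (simp add: C_def)
  qed
  have "\<exists>\<beta>. 0 < N \<longrightarrow> 0 < \<beta> \<and> dual_load (w m) N (\<alpha> N) (S N) \<beta> = 1" for N
  proof (cases "0 < N")
    case True
    then have nonneg: "0 \<le> \<alpha> N n" if "n \<in> S N" for n using \<alpha>_pos[of N n] that by (simp add: S_def)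
    obtain \<beta> where "0 < \<beta>" "dual_load (w m) N (\<alpha> N) (S N) \<beta> = 1"
      by (rule dual_load_eq_1_exists[where a = "\<alpha> N" and S = "S N" and N = N, OF w]) (rule nonneg)
    then show ?thesis by blast
  qed simp
  from choice[OF allI[OF this]]
  obtain \<beta> where "\<forall>N. 0 < N \<longrightarrow> 0 < \<beta> N \<and> dual_load (w m) N (\<alpha> N) (S N) (\<beta> N) = 1" ..
  then have \<beta>: "\<And>N. 0 < N \<Longrightarrow> 0 < \<beta> N" "\<And>N. 0 < N \<Longrightarrow> dual_load (w m) N (\<alpha> N) (S N) (\<beta> N) = 1"
    by simp_all
  define \<gamma> where "\<gamma> N = \<alpha> N m * \<beta> N" for N
  have fixpoint: "x = fixed_point_rhs N (U N) (d N) w (q N) m x \<longleftrightarrow> dual_load (w m) N (\<alpha> N) (S N) (x / \<alpha> N m) = 1"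
    if "0 < N" "m \<in> U N" "0 < x" for N x
  proof -
    have a: "0 < \<alpha> N m" using \<alpha>_pos that by blast
    have "\<alpha> N m * (x / \<alpha> N m) = fixed_point_rhs N (U N) (d N) w (q N) m (\<alpha> N m * (x / \<alpha> N m)) \<longleftrightarrow>
        dual_load (w m) N (\<alpha> N) (S N) (x / \<alpha> N m) = 1"
      unfolding \<alpha>_def[abs_def] S_def b_def
      by (rule fixed_point_rhs_iff)
        (use that w a \<alpha>_pos[of N] in \<open>auto simp: \<alpha>_def b_def less_imp_le\<close>)
    then show ?thesis using a by simp
  qed
  have \<gamma>: "\<gamma> N > 0 \<and> \<gamma> N = fixed_point_rhs N (U N) (d N) w (q N) m (\<gamma> N) \<and>
      (\<forall>x>0. x = fixed_point_rhs N (U N) (d N) w (q N) m x \<longrightarrow> x = \<gamma> N)"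
    if "0 < N" "m \<in> U N" for N
  proof -
    have a: "0 < \<alpha> N m" using \<alpha>_pos that by blast
    then have pos: "\<gamma> N > 0" using \<beta>(1)[OF that(1)] by (simp add: \<gamma>_def)
    have "dual_load (w m) N (\<alpha> N) (S N) (\<gamma> N / \<alpha> N m) = 1"
      using \<beta>(2)[OF that(1)] a by (simp add: \<gamma>_def)
    then have fp: "\<gamma> N = fixed_point_rhs N (U N) (d N) w (q N) m (\<gamma> N)"
      using fixpoint[OF that pos] by blast
    have "x = \<gamma> N" if x: "x > 0" "x = fixed_point_rhs N (U N) (d N) w (q N) m x" for x
    proof -
      have "dual_load (w m) N (\<alpha> N) (S N) (x / \<alpha> N m) = 1"
        using fixpoint[OF \<open>0 < N\<close> \<open>m \<in> U N\<close> x(1)] x(2) by blast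
      \<comment> \<open>Uniqueness: both points have load 1, and the load separates points at rate
        at least \<open>w m\<close>.\<close>
      moreover have "w m * \<bar>x / \<alpha> N m - \<beta> N\<bar> \<le>
          \<bar>dual_load (w m) N (\<alpha> N) (S N) (x / \<alpha> N m) - dual_load (w m) N (\<alpha> N) (S N) (\<beta> N)\<bar>"
        by (rule dual_load_distance[OF w])
          (use \<alpha>_pos[OF \<open>0 < N\<close>] \<beta>(1)[OF \<open>0 < N\<close>] x(1) a in \<open>auto simp: S_def less_imp_le\<close>)
      ultimately have "w m * \<bar>x / \<alpha> N m - \<beta> N\<bar> \<le> 0" using \<beta>(2)[OF \<open>0 < N\<close>] by simp
      then have "x / \<alpha> N m = \<beta> N" using w by (simp add: mult_le_0_iff)
      then show ?thesis using a by (simp add: \<gamma>_def field_simps)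
    qed
    with pos fp show ?thesis by blast
  qed
  \<comment> \<open>\<open>R\<close> lies strictly above the limit superior, so
    \<open>K N / N < R\<close> eventually; with \<open>J\<close> cells this gives the bound
    \<open>\<rho>\<close> on users per antenna.\<close>
  obtain R where R: "limsup (\<lambda>N. ereal (real (K N) / real N)) < ereal R"
    using assms(4) ereal_dense2 by blast
  have "eventually (\<lambda>N. ereal (real (K N) / real N) < ereal R) sequentially"
    by (rule Limsup_lessD[OF R])
  moreover have "eventually (\<lambda>N. snd m \<le> K N) sequentially"
    using assms(2) by (simp add: filterlim_at_top)
  ultimately have "eventually (\<lambda>N. ereal (real (K N) / real N) < ereal R \<and> snd m \<le> K N \<and> 0 < N) sequentially"
    using eventually_gt_at_top[of 0] by eventually_elim simp
  then obtain N0 where N0: "\<And>N. N0 \<le> N \<Longrightarrow> ereal (real (K N) / real N) < ereal R \<and> snd m \<le> K N \<and> 0 < N"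
    by (auto simp: eventually_sequentially)
  have N_pos: "0 < N" and mU: "m \<in> U N" if "N0 \<le> N" for N
    using N0[OF that] assms(11) by (auto simp: U_def users_def mem_Times_iff)
  define \<rho> where "\<rho> = real J * R"
  have card_S: "real (card (S N)) \<le> \<rho> * real N" if "N0 \<le> N" for N
  proof -
    have "card (S N) \<le> card (U N)" unfolding S_def by (rule card_mono[OF finU]) blast
    also have "card (U N) = J * K N" by (simp add: U_def users_def card_cartesian_product)
    finally have card: "real (card (S N)) \<le> real J * real (K N)" by (metis of_nat_le_iff of_nat_mult)
    have "real (K N) / real N < R" using N0[OF that] by simp
    then have "real (K N) \<le> R * real N" using N_pos[OF that] by (simp add: pos_divide_less_eq)
    then have "real J * real (K N) \<le> real J * (R * real N)" by (intro mult_left_mono) auto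
    with card show ?thesis by (simp add: \<rho>_def mult.assoc)
  qed
  define c where "c N n = \<alpha> N n / real N" for N n
  define G where "G N \<omega> n i = H N b n i \<omega>" for N \<omega> n i
  define D where "D N n \<omega> = ridge_form N (w m) (c N) (G N \<omega>) (S N - {n}) (G N \<omega> n)
      - ridge_trace N (w m) (c N) (G N \<omega>) (S N - {n})" for N n \<omega>
  \<comment> \<open>\<open>106 = 1 + 105\<close>, where 105 is the eighth-moment bound for the
    Gaussian entries.\<close>
  define V where "V = 728 * 106\<^sup>2 / (w m)\<^sup>2"
  have D: "mom4 M (D N n)" "(\<integral>\<omega>. D N n \<omega> ^ 4 \<partial>M) \<le> (V * real N)\<^sup>2" if "0 < N" "n \<in> U N" for N n
  proof -
    have indep: "indep_vars (\<lambda>_. borel) (\<lambda>(n, i). H N b n i) (U N \<times> {..<N})"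
    proof -
      \<comment> \<open>Fixing the base station \<open>b\<close> embeds the pairs of user and
        antenna into the index triples.\<close>
      have "indep_vars (\<lambda>_. borel) (\<lambda>p. (\<lambda>(b, n, i). H N b n i) (b, p)) (U N \<times> {..<N})"
        by (rule indep_vars_reindex[OF assms(10)[OF that(1)]]) (use b in \<open>auto simp: U_def inj_on_def\<close>)
      then show ?thesis by simp
    qed
    have "indep_vars (\<lambda>_. borel) (\<lambda>i. (\<lambda>(n, i). H N b n i) (n, i)) {..<N}"
      by (rule indep_vars_reindex[OF indep]) (use that in \<open>auto simp: inj_on_def\<close>)
    then have "indep_vars (\<lambda>_. borel) (H N b n) {..<N}" by simp
    then have col: "white_vector M (H N b n) N 105"
      by (rule std_complex_normal_white_vector) (use assms(9) that b in \<open>auto simp: U_def\<close>)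
    have n: "n \<notin> S N - {n}" "S N - {n} \<subseteq> U N" "finite (S N - {n})" using finU by (auto simp: S_def)
    have c: "0 \<le> c N k" if "k \<in> S N - {n}" for k
      using \<alpha>_pos[of N k] that \<open>0 < N\<close> by (simp add: c_def S_def)
    show "mom4 M (D N n)"
      unfolding D_def[abs_def] G_def[abs_def]
      by (rule ridge_form_moment(1)[OF indep that(2) n w _ col]) (rule c)
    have "(\<integral>\<omega>. D N n \<omega> ^ 4 \<partial>M) \<le> (728 * (1 + 105)\<^sup>2 * real N / (w m)\<^sup>2)\<^sup>2"
      unfolding D_def[abs_def] G_def[abs_def]
      by (rule ridge_form_moment(2)[OF indep that(2) n w _ col]) (rule c)
    then show "(\<integral>\<omega>. D N n \<omega> ^ 4 \<partial>M) \<le> (V * real N)\<^sup>2" by (simp add: V_def)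
  qed
  \<comment> \<open>The random part of the bound in \<open>ridge_form_deviation\<close>; the part
    left out is at most a constant times \<open>1 / N\<close>.\<close>
  define X where "X N \<omega> = \<bar>D N m \<omega>\<bar> / real N + C / w m * ((\<Sum>n\<in>S N. \<bar>D N n \<omega>\<bar>) / (real N)\<^sup>2)" for N \<omega>
  have X: "mom4 M (X N)"
    "(\<integral>\<omega>. X N \<omega> ^ 4 \<partial>M) \<le> 8 * V\<^sup>2 * (1 + (C / w m) ^ 4 * \<rho> ^ 4) * inverse (real N ^ 2)" if "N0 \<le> N" for N
  proof -
    have ins: "insert m (S N) = U N" using mU[OF that] by (auto simp: S_def)
    have fin: "finite (S N)" using finU by (simp add: S_def)
    have e: "0 \<le> C / w m" using C w by simp
    have D1: "mom4 M (D N n)" and D2: "(\<integral>\<omega>. D N n \<omega> ^ 4 \<partial>M) \<le> (V * real N)\<^sup>2"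
      if "n \<in> insert m (S N)" for n
      using D[OF N_pos[OF \<open>N0 \<le> N\<close>], of n] that unfolding ins by simp_all
    show "mom4 M (X N)" unfolding X_def[abs_def]
      by (rule deviation_moment(1)[where V = V, OF D1 D2 N_pos[OF that] fin card_S[OF that] e])
    show "(\<integral>\<omega>. X N \<omega> ^ 4 \<partial>M) \<le> 8 * V\<^sup>2 * (1 + (C / w m) ^ 4 * \<rho> ^ 4) * inverse (real N ^ 2)"
      unfolding X_def
      by (rule deviation_moment(2)[where V = V, OF D1 D2 N_pos[OF that] fin card_S[OF that] e])
  qed
  have AE: "AE \<omega> in M. (\<lambda>N. X N \<omega>) \<longlonglongrightarrow> 0"
  proof (rule AE_tendsto_0_of_fourth_moments)
    show "mom4 M (X N)" "(\<integral>\<omega>. X N \<omega> ^ 4 \<partial>M) \<le> 8 * V\<^sup>2 * (1 + (C / w m) ^ 4 * \<rho> ^ 4) * inverse (real N ^ 2)"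
      if "N0 \<le> N" for N
      using X[OF that] .
    show "summable (\<lambda>N. 8 * V\<^sup>2 * (1 + (C / w m) ^ 4 * \<rho> ^ 4) * inverse (real N ^ 2))"
      by (intro summable_mult inverse_power_summable) simp
    have "0 \<le> 8 * V\<^sup>2 * (1 + (C / w m) ^ 4 * \<rho> ^ 4)"
      by (intro mult_nonneg_nonneg add_nonneg_nonneg) simp_all
    then show "0 \<le> 8 * V\<^sup>2 * (1 + (C / w m) ^ 4 * \<rho> ^ 4) * inverse (real N ^ 2)" for N
      by (rule mult_nonneg_nonneg) simp
  qed
  \<comment> \<open>An inequality for every outcome, so the exceptional null set is the one
    belonging to \<open>X\<close>.\<close>
  have bound: "norm (SINR_DN N (U N) (d N) w (q N) (\<lambda>b n. vec N (\<lambda>i. H N b n i \<omega>)) m - complex_of_real (\<gamma> N))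
      \<le> C * (X N \<omega> + C / w m * (\<rho> / w m * (1 / real N)))" if N: "N0 \<le> N" for N \<omega>
  proof -
    note Np = N_pos[OF N]
    have am: "0 < \<alpha> N m" "\<alpha> N m \<le> C" using \<alpha>_pos \<alpha>_le Np mU[OF N] by blast+
    have nonneg: "0 \<le> q N n * d N (fst m) n" if "n \<in> U N - {m}" for n
      using \<alpha>_pos[OF Np, of n] that by (simp add: \<alpha>_def b_def)
    interpret ridge N "w m" "c N" "G N \<omega>" "U N"
      by unfold_locales (use w finU \<alpha>_pos[OF Np] in \<open>auto simp: c_def less_imp_le\<close>)
    define f where "f = ridge_form N (w m) (c N) (G N \<omega>) (S N) (G N \<omega> m)"
    have SINR: "SINR_DN N (U N) (d N) w (q N) (\<lambda>b n. vec N (\<lambda>i. H N b n i \<omega>)) m = complex_of_real (\<alpha> N m * (f / N))"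
    proof -
      have "SINR_DN N (U N) (d N) w (q N) (\<lambda>b n. vec N (\<lambda>i. H N b n i \<omega>)) m =
          complex_of_real (q N m * d N (fst m) m * (ridge_form N (w m) (\<lambda>n. q N n * d N (fst m) n / real N)
            (\<lambda>n i. H N (fst m) n i \<omega>) (U N - {m}) (\<lambda>i. H N (fst m) m i \<omega>) / real N))"
        by (rule SINR_DN_ridge_form[where G = "\<lambda>b n i. H N b n i \<omega>" and U = "U N" and w = w and m = m, OF Np w finU]) (rule nonneg)
      then show ?thesis by (simp add: f_def \<alpha>_def[abs_def] b_def c_def[abs_def] G_def[abs_def] S_def)
    qed
    have Nc: "(\<lambda>n. real N * c N n) = \<alpha> N" using Np by (simp add: c_def[abs_def])
    have "\<bar>f / N - \<beta> N\<bar> \<le> \<bar>D N m \<omega>\<bar> / N + C / w m * ((\<Sum>n\<in>S N. \<bar>D N n \<omega>\<bar>) / (real N)\<^sup>2 + card (S N) / (w m * (real N)\<^sup>2))"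
      unfolding f_def D_def
    proof (rule ridge_form_deviation[OF Np])
      show "dual_load (w m) N (\<lambda>n. real N * c N n) (S N) (\<beta> N) = 1" unfolding Nc by (rule \<beta>(2)[OF Np])
      show "real N * c N n \<le> C" if "n \<in> S N" for n
        using \<alpha>_le[OF Np, of n] that Np by (simp add: c_def S_def)
    qed (use \<beta>(1)[OF Np] C in \<open>auto simp: S_def\<close>)
    also have "\<dots> = X N \<omega> + C / w m * (card (S N) / (w m * (real N)\<^sup>2))"
      unfolding X_def by (simp add: distrib_left)
    also have "\<dots> \<le> X N \<omega> + C / w m * (\<rho> / w m * (1 / real N))"
    proof -
      have "card (S N) / (w m * (real N)\<^sup>2) \<le> (\<rho> * real N) / (w m * (real N)\<^sup>2)"
        using card_S[OF N] w Np by (intro divide_right_mono) auto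
      also have "\<dots> = \<rho> / w m * (1 / real N)" using Np by (simp add: power2_eq_square)
      finally show ?thesis using C w by (intro add_left_mono mult_left_mono) auto
    qed
    finally have dev: "\<bar>f / N - \<beta> N\<bar> \<le> X N \<omega> + C / w m * (\<rho> / w m * (1 / real N))" .
    have "norm (SINR_DN N (U N) (d N) w (q N) (\<lambda>b n. vec N (\<lambda>i. H N b n i \<omega>)) m - complex_of_real (\<gamma> N))
        = \<alpha> N m * \<bar>f / N - \<beta> N\<bar>"
      unfolding SINR \<gamma>_def of_real_diff[symmetric] norm_of_real right_diff_distrib[symmetric]
      using am by (simp add: abs_mult)
    also have "\<dots> \<le> C * (X N \<omega> + C / w m * (\<rho> / w m * (1 / real N)))"
      by (rule mult_mono[OF am(2) dev C]) simp
    finally show ?thesis .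
  qed
  have conv: "AE \<omega> in M. (\<lambda>N. SINR_DN N (U N) (d N) w (q N) (\<lambda>b n. vec N (\<lambda>i. H N b n i \<omega>)) m - complex_of_real (\<gamma> N)) \<longlonglongrightarrow> 0"
    using AE
  proof (rule AE_mp, intro AE_I2 impI)
    fix \<omega> assume X0: "(\<lambda>N. X N \<omega>) \<longlonglongrightarrow> 0"
    have "(\<lambda>N. C * (X N \<omega> + C / w m * (\<rho> / w m * (1 / real N)))) \<longlonglongrightarrow> C * (0 + C / w m * (\<rho> / w m * 0))"
      by (intro tendsto_intros X0 lim_1_over_n)
    then have lim: "(\<lambda>N. C * (X N \<omega> + C / w m * (\<rho> / w m * (1 / real N)))) \<longlonglongrightarrow> 0" by simp
    show "(\<lambda>N. SINR_DN N (U N) (d N) w (q N) (\<lambda>b n. vec N (\<lambda>i. H N b n i \<omega>)) m - complex_of_real (\<gamma> N)) \<longlonglongrightarrow> 0"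
      by (rule Lim_null_comparison[OF _ lim], rule eventually_sequentiallyI[of N0], rule bound)
  qed
  show ?thesis
  proof (rule exI[of _ \<gamma>], rule conjI, intro allI impI)
    fix N assume "0 < N" "m \<in> users J (K N)"
    then show "\<gamma> N > 0 \<and> \<gamma> N = fixed_point_rhs N (users J (K N)) (d N) w (q N) m (\<gamma> N) \<and>
        (\<forall>x>0. x = fixed_point_rhs N (users J (K N)) (d N) w (q N) m x \<longrightarrow> x = \<gamma> N)"
      by (rule \<gamma>[unfolded U_def])
  qed (rule conv[unfolded U_def])
qed

end
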